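(* Let $A$ and $B$ be separable rings in $\mathcal K$, where $A$ has finite degree and $B$ is indecomposable. Then there are at most $\deg(A)$ distinct ring morphisms from $A$ to $B$ in $\mathcal K$.
   Context: $(\mathcal K,\otimes,\mathbb 1)$ is an idempotent-complete symmetric monoidal category: $\mathcal K$ is additive, $\otimes$ is additive in each variable, and every $e:x\to x$ with $e^2=e$ yields a decomposition $x\cong x_1\oplus x_2$ under which $e$ becomes $\left(\begin{smallmatrix}1&0\\0&0\end{smallmatrix}\right)$. Rings. A ring in $\mathcal K$ is a commutative monoid $(A,\mu:A\otimes A\to A,\eta:\mathbb 1\to A)$ in $\mathcal K$ (associative, commutative, two-sided unit). Ring morphisms are morphisms in $\mathcal K$ compatible with multiplication and unit. $A\otimes B$ is the ring with multiplication $\mu_A\otimes\mu_B$ precomposed with the swap of the two middle factors; $A\times B$ is $A\oplus B$ with componentwise multiplication. $A$ is separable if there is $\sigma:A\to A\otimes A$ with $\mu\sigma=1_A$ and $(1\otimes\mu)(\sigma\otimes1)=\sigma\mu=(\mu\otimes1)(1\otimes\sigma)$. An $A$-algebra is a ring $B$ with a ring morphism $A\to B$. A ring $A$ is indecomposable if it is nonzero and the only idempotent $A$-linear endomorphisms $A\to A$ are $1_A$ and $0$ (equivalently, $A$ is nonzero and is not a product of two nonzero rings). Modules. For $A$ separable, $A\text{-}\mathrm{Mod}_{\mathcal K}$ is the category of left $A$-modules in $\mathcal K$ with $A$-linear morphisms; it is idempotent-complete symmetric monoidal under $\otimes_A$, where $x\otimes_A y$ is the coequaliser of the two action maps $x\otimes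 A\otimes y\rightrightarrows x\otimes y$, with unit $\mathbb 1_A=A$. $A$-algebras in $\mathcal K$ correspond to rings in $A\text{-}\mathrm{Mod}_{\mathcal K}$, and separability is the same in both senses. Degree. For a separable ring $A$ there is a separable $A$-algebra $A'$, unique up to isomorphism of $A$-algebras, with a ring isomorphism $h:A\otimes A\to A\times A'$ such that $\mathrm{pr}_1h=\mu$, where $A'$ is an $A$-algebra via $\mathrm{pr}_2h(1_A\otimes\eta)$. Define $A^{[0]}=\mathbb 1$, $A^{[1]}=A$, and inductively $A^{[n+1]}=(A^{[n]})'$, where $A^{[n]}$ is regarded as a ring in $A^{[n-1]}\text{-}\mathrm{Mod}_{\mathcal K}$. The degree $\deg(A)=\deg_{\mathcal K}(A)$ is $d$ if $A^{[d]}\ne0$ and $A^{[d+1]}=0$; it is infinite if $A^{[d]}\neq0$ for all $d\ge 0$. *)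

theory Defs
  imports Main "HOL-Library.Extended_Nat"
begin

section \<open>Additive symmetric monoidal categories\<close>

text \<open>Categories are given by a set of objects and a set of arrows, each arrow having a domain
  and a codomain.  \<open>g \<cdot> f\<close> is composition (first \<open>f\<close>, then \<open>g\<close>); the operations on
  arrows are only meaningful on composable, respectively parallel, arrows.\<close>

record ('o, 'm) addcat =
  Ob :: "'o set"
  Arr :: "'m set"
  Dom :: "'m \<Rightarrow> 'o"
  Cod :: "'m \<Rightarrow> 'o"
  Id :: "'o \<Rightarrow> 'm"
  Comp :: "'m \<Rightarrow> 'm \<Rightarrow> 'm"  (infixr "\<cdot>\<index>" 70)
  Add :: "'m \<Rightarrow> 'm \<Rightarrow> 'm"  (infixl "\<oplus>\<index>" 65)
  Zero :: "'o \<Rightarrow> 'o \<Rightarrow> 'm"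

text \<open>\<open>x \<otimes> y\<close> is the tensor product of objects and \<open>f \<boxtimes> g\<close> that of arrows;
  \<open>Assoc x y z : (x \<otimes> y) \<otimes> z \<rightarrow> x \<otimes> (y \<otimes> z)\<close>,
  \<open>LUnit x : \<one> \<otimes> x \<rightarrow> x\<close>, \<open>RUnit x : x \<otimes> \<one> \<rightarrow> x\<close> and
  \<open>Swap x y : x \<otimes> y \<rightarrow> y \<otimes> x\<close>.\<close>

record ('o, 'm) moncat = "('o, 'm) addcat" +
  TensOb :: "'o \<Rightarrow> 'o \<Rightarrow> 'o"  (infixl "\<otimes>\<index>" 75)
  TensArr :: "'m \<Rightarrow> 'm \<Rightarrow> 'm"  (infixl "\<boxtimes>\<index>" 75)
  UnitOb :: "'o"  ("\<one>\<index>")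
  Assoc :: "'o \<Rightarrow> 'o \<Rightarrow> 'o \<Rightarrow> 'm"
  LUnit :: "'o \<Rightarrow> 'm"
  RUnit :: "'o \<Rightarrow> 'm"
  Swap :: "'o \<Rightarrow> 'o \<Rightarrow> 'm"

definition hom :: "('o, 'm, 'x) addcat_scheme \<Rightarrow> 'o \<Rightarrow> 'o \<Rightarrow> 'm set" where
  "hom C x y = {f \<in> Arr C. Dom C f = x \<and> Cod C f = y}"

definition iso_arr :: "('o, 'm, 'x) addcat_scheme \<Rightarrow> 'm \<Rightarrow> bool" where
  "iso_arr C f \<longleftrightarrow> f \<in> Arr C \<and>
     (\<exists>g \<in> hom C (Cod C f) (Dom C f).
        g \<cdot>\<^bsub>C\<^esub> f = Id C (Dom C f) \<and> f \<cdot>\<^bsub>C\<^esub> g = Id C (Cod C f))"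

definition inverse_arr :: "('o, 'm, 'x) addcat_scheme \<Rightarrow> 'm \<Rightarrow> 'm" where
  "inverse_arr C f = (THE g. g \<in> hom C (Cod C f) (Dom C f) \<and>
     g \<cdot>\<^bsub>C\<^esub> f = Id C (Dom C f) \<and> f \<cdot>\<^bsub>C\<^esub> g = Id C (Cod C f))"

definition zero_object :: "('o, 'm, 'x) addcat_scheme \<Rightarrow> 'o \<Rightarrow> bool" where
  "zero_object C x \<longleftrightarrow> x \<in> Ob C \<and>
     (\<forall>y \<in> Ob C. (\<exists>!f. f \<in> hom C x y) \<and> (\<exists>!f. f \<in> hom C y x))"

definition biproduct ::
  "('o, 'm, 'x) addcat_scheme \<Rightarrow> 'o \<Rightarrow> 'o \<Rightarrow> 'o \<Rightarrow> 'm \<Rightarrow> 'm \<Rightarrow> 'm \<Rightarrow> 'm \<Rightarrow> bool" where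
  "biproduct C s x y i\<^sub>1 i\<^sub>2 p\<^sub>1 p\<^sub>2 \<longleftrightarrow>
     i\<^sub>1 \<in> hom C x s \<and> i\<^sub>2 \<in> hom C y s \<and> p\<^sub>1 \<in> hom C s x \<and> p\<^sub>2 \<in> hom C s y \<and>
     p\<^sub>1 \<cdot>\<^bsub>C\<^esub> i\<^sub>1 = Id C x \<and> p\<^sub>2 \<cdot>\<^bsub>C\<^esub> i\<^sub>2 = Id C y \<and>
     p\<^sub>1 \<cdot>\<^bsub>C\<^esub> i\<^sub>2 = Zero C y x \<and> p\<^sub>2 \<cdot>\<^bsub>C\<^esub> i\<^sub>1 = Zero C x y \<and>
     (i\<^sub>1 \<cdot>\<^bsub>C\<^esub> p\<^sub>1) \<oplus>\<^bsub>C\<^esub> (i\<^sub>2 \<cdot>\<^bsub>C\<^esub> p\<^sub>2) = Id C s"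

definition coequaliser :: "('o, 'm, 'x) addcat_scheme \<Rightarrow> 'm \<Rightarrow> 'm \<Rightarrow> 'm \<Rightarrow> bool" where
  "coequaliser C f g q \<longleftrightarrow>
     f \<in> Arr C \<and> g \<in> hom C (Dom C f) (Cod C f) \<and> q \<in> Arr C \<and> Dom C q = Cod C f \<and>
     q \<cdot>\<^bsub>C\<^esub> f = q \<cdot>\<^bsub>C\<^esub> g \<and>
     (\<forall>h \<in> Arr C. Dom C h = Cod C f \<and> h \<cdot>\<^bsub>C\<^esub> f = h \<cdot>\<^bsub>C\<^esub> g \<longrightarrow>
        (\<exists>!k. k \<in> hom C (Cod C q) (Cod C h) \<and> k \<cdot>\<^bsub>C\<^esub> q = h))"

locale additive_category =
  fixes C :: "('o, 'm, 'x) addcat_scheme" (structure)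
  assumes arr_ob: "f \<in> Arr C \<Longrightarrow> Dom C f \<in> Ob C \<and> Cod C f \<in> Ob C"
    and id_hom: "x \<in> Ob C \<Longrightarrow> Id C x \<in> hom C x x"
    and comp_hom: "\<lbrakk>f \<in> hom C x y; g \<in> hom C y z\<rbrakk> \<Longrightarrow> g \<cdot> f \<in> hom C x z"
    and comp_id: "f \<in> hom C x y \<Longrightarrow> f \<cdot> Id C x = f"
    and id_comp: "f \<in> hom C x y \<Longrightarrow> Id C y \<cdot> f = f"
    and comp_assoc: "\<lbrakk>f \<in> hom C w x; g \<in> hom C x y; h \<in> hom C y z\<rbrakk> \<Longrightarrow> (h \<cdot> g) \<cdot> f = h \<cdot> (g \<cdot> f)"
    and add_hom: "\<lbrakk>f \<in> hom C x y; g \<in> hom C x y\<rbrakk> \<Longrightarrow> f \<oplus> g \<in> hom C x y"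
    and add_assoc: "\<lbrakk>f \<in> hom C x y; g \<in> hom C x y; h \<in> hom C x y\<rbrakk> \<Longrightarrow> (f \<oplus> g) \<oplus> h = f \<oplus> (g \<oplus> h)"
    and add_comm: "\<lbrakk>f \<in> hom C x y; g \<in> hom C x y\<rbrakk> \<Longrightarrow> f \<oplus> g = g \<oplus> f"
    and zero_hom: "\<lbrakk>x \<in> Ob C; y \<in> Ob C\<rbrakk> \<Longrightarrow> Zero C x y \<in> hom C x y"
    and add_zero: "f \<in> hom C x y \<Longrightarrow> f \<oplus> Zero C x y = f"
    and add_inverse: "f \<in> hom C x y \<Longrightarrow> \<exists>g \<in> hom C x y. f \<oplus> g = Zero C x y"
    and comp_add_left: "\<lbrakk>f \<in> hom C x y; g \<in> hom C y z; h \<in> hom C y z\<rbrakk> \<Longrightarrow>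
          (g \<oplus> h) \<cdot> f = (g \<cdot> f) \<oplus> (h \<cdot> f)"
    and comp_add_right: "\<lbrakk>f \<in> hom C x y; g \<in> hom C x y; h \<in> hom C y z\<rbrakk> \<Longrightarrow>
          h \<cdot> (f \<oplus> g) = (h \<cdot> f) \<oplus> (h \<cdot> g)"
    and zero_object_exists: "\<exists>z. zero_object C z"
    and biproduct_exists: "\<lbrakk>x \<in> Ob C; y \<in> Ob C\<rbrakk> \<Longrightarrow> \<exists>s i\<^sub>1 i\<^sub>2 p\<^sub>1 p\<^sub>2. biproduct C s x y i\<^sub>1 i\<^sub>2 p\<^sub>1 p\<^sub>2"

locale symmetric_monoidal_category = additive_category C
  for C :: "('o, 'm, 'x) moncat_scheme" (structure) +
  assumes unit_ob: "\<one> \<in> Ob C"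
    and tens_ob: "\<lbrakk>x \<in> Ob C; y \<in> Ob C\<rbrakk> \<Longrightarrow> x \<otimes> y \<in> Ob C"
    and tens_hom: "\<lbrakk>f \<in> hom C x x'; g \<in> hom C y y'\<rbrakk> \<Longrightarrow> f \<boxtimes> g \<in> hom C (x \<otimes> y) (x' \<otimes> y')"
    and tens_id: "\<lbrakk>x \<in> Ob C; y \<in> Ob C\<rbrakk> \<Longrightarrow> Id C x \<boxtimes> Id C y = Id C (x \<otimes> y)"
    and tens_comp: "\<lbrakk>f \<in> hom C x x'; f' \<in> hom C x' x''; g \<in> hom C y y'; g' \<in> hom C y' y''\<rbrakk> \<Longrightarrow>
          (f' \<cdot> f) \<boxtimes> (g' \<cdot> g) = (f' \<boxtimes> g') \<cdot> (f \<boxtimes> g)"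
    and tens_add_left: "\<lbrakk>f \<in> hom C x x'; f' \<in> hom C x x'; g \<in> hom C y y'\<rbrakk> \<Longrightarrow>
          (f \<oplus> f') \<boxtimes> g = (f \<boxtimes> g) \<oplus> (f' \<boxtimes> g)"
    and tens_add_right: "\<lbrakk>f \<in> hom C x x'; g \<in> hom C y y'; g' \<in> hom C y y'\<rbrakk> \<Longrightarrow>
          f \<boxtimes> (g \<oplus> g') = (f \<boxtimes> g) \<oplus> (f \<boxtimes> g')"
    and assoc_hom: "\<lbrakk>x \<in> Ob C; y \<in> Ob C; z \<in> Ob C\<rbrakk> \<Longrightarrow>
          Assoc C x y z \<in> hom C ((x \<otimes> y) \<otimes> z) (x \<otimes> (y \<otimes> z))"
    and assoc_iso: "\<lbrakk>x \<in> Ob C; y \<in> Ob C; z \<in> Ob C\<rbrakk> \<Longrightarrow> iso_arr C (Assoc C x y z)"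
    and assoc_natural: "\<lbrakk>f \<in> hom C x x'; g \<in> hom C y y'; h \<in> hom C z z'\<rbrakk> \<Longrightarrow>
          Assoc C x' y' z' \<cdot> ((f \<boxtimes> g) \<boxtimes> h) = (f \<boxtimes> (g \<boxtimes> h)) \<cdot> Assoc C x y z"
    and lunit_hom: "x \<in> Ob C \<Longrightarrow> LUnit C x \<in> hom C (\<one> \<otimes> x) x"
    and lunit_iso: "x \<in> Ob C \<Longrightarrow> iso_arr C (LUnit C x)"
    and lunit_natural: "f \<in> hom C x x' \<Longrightarrow> LUnit C x' \<cdot> (Id C \<one> \<boxtimes> f) = f \<cdot> LUnit C x"
    and runit_hom: "x \<in> Ob C \<Longrightarrow> RUnit C x \<in> hom C (x \<otimes> \<one>) x"
    and runit_iso: "x \<in> Ob C \<Longrightarrow> iso_arr C (RUnit C x)"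
    and runit_natural: "f \<in> hom C x x' \<Longrightarrow> RUnit C x' \<cdot> (f \<boxtimes> Id C \<one>) = f \<cdot> RUnit C x"
    and swap_hom: "\<lbrakk>x \<in> Ob C; y \<in> Ob C\<rbrakk> \<Longrightarrow> Swap C x y \<in> hom C (x \<otimes> y) (y \<otimes> x)"
    and swap_natural: "\<lbrakk>f \<in> hom C x x'; g \<in> hom C y y'\<rbrakk> \<Longrightarrow>
          Swap C x' y' \<cdot> (f \<boxtimes> g) = (g \<boxtimes> f) \<cdot> Swap C x y"
    and swap_swap: "\<lbrakk>x \<in> Ob C; y \<in> Ob C\<rbrakk> \<Longrightarrow> Swap C y x \<cdot> Swap C x y = Id C (x \<otimes> y)"
    and pentagon: "\<lbrakk>w \<in> Ob C; x \<in> Ob C; y \<in> Ob C; z \<in> Ob C\<rbrakk> \<Longrightarrow>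
          Assoc C w x (y \<otimes> z) \<cdot> Assoc C (w \<otimes> x) y z =
          (Id C w \<boxtimes> Assoc C x y z) \<cdot> Assoc C w (x \<otimes> y) z \<cdot> (Assoc C w x y \<boxtimes> Id C z)"
    and triangle: "\<lbrakk>x \<in> Ob C; y \<in> Ob C\<rbrakk> \<Longrightarrow>
          (Id C x \<boxtimes> LUnit C y) \<cdot> Assoc C x \<one> y = RUnit C x \<boxtimes> Id C y"
    and hexagon: "\<lbrakk>x \<in> Ob C; y \<in> Ob C; z \<in> Ob C\<rbrakk> \<Longrightarrow>
          Assoc C y z x \<cdot> Swap C x (y \<otimes> z) \<cdot> Assoc C x y z =
          (Id C y \<boxtimes> Swap C x z) \<cdot> Assoc C y x z \<cdot> (Swap C x y \<boxtimes> Id C z)"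

locale idempotent_complete_smc = symmetric_monoidal_category C
  for C :: "('o, 'm, 'x) moncat_scheme" (structure) +
  assumes idempotent_splits: "\<lbrakk>e \<in> hom C x x; e \<cdot> e = e\<rbrakk> \<Longrightarrow>
    \<exists>x\<^sub>1 x\<^sub>2 i\<^sub>1 i\<^sub>2 p\<^sub>1 p\<^sub>2. biproduct C x x\<^sub>1 x\<^sub>2 i\<^sub>1 i\<^sub>2 p\<^sub>1 p\<^sub>2 \<and> e = i\<^sub>1 \<cdot> p\<^sub>1"


section \<open>Rings\<close>

record ('o, 'm) ring_data =
  rob :: 'o
  rmul :: 'm
  rone :: 'm

definition ring :: "('o, 'm, 'x) moncat_scheme \<Rightarrow> ('o, 'm) ring_data \<Rightarrow> bool" where
  "ring C A \<longleftrightarrow> (let a = rob A; \<mu> = rmul A; \<eta> = rone A; I = Id C a in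
     a \<in> Ob C \<and> \<mu> \<in> hom C (a \<otimes>\<^bsub>C\<^esub> a) a \<and> \<eta> \<in> hom C \<one>\<^bsub>C\<^esub> a \<and>
     \<mu> \<cdot>\<^bsub>C\<^esub> (\<mu> \<boxtimes>\<^bsub>C\<^esub> I) = \<mu> \<cdot>\<^bsub>C\<^esub> (I \<boxtimes>\<^bsub>C\<^esub> \<mu>) \<cdot>\<^bsub>C\<^esub> Assoc C a a a \<and>
     \<mu> \<cdot>\<^bsub>C\<^esub> Swap C a a = \<mu> \<and>
     \<mu> \<cdot>\<^bsub>C\<^esub> (\<eta> \<boxtimes>\<^bsub>C\<^esub> I) = LUnit C a \<and>
     \<mu> \<cdot>\<^bsub>C\<^esub> (I \<boxtimes>\<^bsub>C\<^esub> \<eta>) = RUnit C a)"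

definition ring_morphism ::
  "('o, 'm, 'x) moncat_scheme \<Rightarrow> ('o, 'm) ring_data \<Rightarrow> ('o, 'm) ring_data \<Rightarrow> 'm \<Rightarrow> bool" where
  "ring_morphism C A B f \<longleftrightarrow>
     f \<in> hom C (rob A) (rob B) \<and>
     f \<cdot>\<^bsub>C\<^esub> rmul A = rmul B \<cdot>\<^bsub>C\<^esub> (f \<boxtimes>\<^bsub>C\<^esub> f) \<and>
     f \<cdot>\<^bsub>C\<^esub> rone A = rone B"

definition unit_ring :: "('o, 'm, 'x) moncat_scheme \<Rightarrow> ('o, 'm) ring_data" where
  "unit_ring C = \<lparr>rob = \<one>\<^bsub>C\<^esub>, rmul = LUnit C \<one>\<^bsub>C\<^esub>, rone = Id C \<one>\<^bsub>C\<^esub>\<rparr>"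

text \<open>The swap of the middle factors \<open>(w \<otimes> x) \<otimes> (y \<otimes> z) \<rightarrow> (w \<otimes> y) \<otimes> (x \<otimes> z)\<close>.\<close>

definition middle_swap ::
  "('o, 'm, 'x) moncat_scheme \<Rightarrow> 'o \<Rightarrow> 'o \<Rightarrow> 'o \<Rightarrow> 'o \<Rightarrow> 'm" where
  "middle_swap C w x y z =
     inverse_arr C (Assoc C w y (x \<otimes>\<^bsub>C\<^esub> z)) \<cdot>\<^bsub>C\<^esub>
     (Id C w \<boxtimes>\<^bsub>C\<^esub>
       (Assoc C y x z \<cdot>\<^bsub>C\<^esub> (Swap C x y \<boxtimes>\<^bsub>C\<^esub> Id C z) \<cdot>\<^bsub>C\<^esub> inverse_arr C (Assoc C x y z))) \<cdot>\<^bsub>C\<^esub>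
     Assoc C w x (y \<otimes>\<^bsub>C\<^esub> z)"

definition tensor_ring ::
  "('o, 'm, 'x) moncat_scheme \<Rightarrow> ('o, 'm) ring_data \<Rightarrow> ('o, 'm) ring_data \<Rightarrow> ('o, 'm) ring_data" where
  "tensor_ring C A B =
     \<lparr>rob = rob A \<otimes>\<^bsub>C\<^esub> rob B,
      rmul = (rmul A \<boxtimes>\<^bsub>C\<^esub> rmul B) \<cdot>\<^bsub>C\<^esub> middle_swap C (rob A) (rob B) (rob A) (rob B),
      rone = (rone A \<boxtimes>\<^bsub>C\<^esub> rone B) \<cdot>\<^bsub>C\<^esub> inverse_arr C (LUnit C \<one>\<^bsub>C\<^esub>)\<rparr>"

text \<open>\<open>P\<close> is the product ring \<open>A \<times> B\<close> on a biproduct \<open>A \<oplus> B\<close> (determined only up to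
  isomorphism); the multiplication of \<open>P\<close> is componentwise exactly when both projections are
  ring morphisms.\<close>

definition product_ring ::
  "('o, 'm, 'x) moncat_scheme \<Rightarrow> ('o, 'm) ring_data \<Rightarrow> ('o, 'm) ring_data \<Rightarrow>
   ('o, 'm) ring_data \<Rightarrow> 'm \<Rightarrow> 'm \<Rightarrow> bool" where
  "product_ring C P A B p\<^sub>1 p\<^sub>2 \<longleftrightarrow>
     ring C P \<and> ring_morphism C P A p\<^sub>1 \<and> ring_morphism C P B p\<^sub>2 \<and>
     (\<exists>i\<^sub>1 i\<^sub>2. biproduct C (rob P) (rob A) (rob B) i\<^sub>1 i\<^sub>2 p\<^sub>1 p\<^sub>2)"

definition separable_ring :: "('o, 'm, 'x) moncat_scheme \<Rightarrow> ('o, 'm) ring_data \<Rightarrow> bool" where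
  "separable_ring C A \<longleftrightarrow> ring C A \<and> (let a = rob A; \<mu> = rmul A; I = Id C a in
     \<exists>\<sigma> \<in> hom C a (a \<otimes>\<^bsub>C\<^esub> a).
       \<mu> \<cdot>\<^bsub>C\<^esub> \<sigma> = I \<and>
       (I \<boxtimes>\<^bsub>C\<^esub> \<mu>) \<cdot>\<^bsub>C\<^esub> Assoc C a a a \<cdot>\<^bsub>C\<^esub> (\<sigma> \<boxtimes>\<^bsub>C\<^esub> I) = \<sigma> \<cdot>\<^bsub>C\<^esub> \<mu> \<and>
       (\<mu> \<boxtimes>\<^bsub>C\<^esub> I) \<cdot>\<^bsub>C\<^esub> inverse_arr C (Assoc C a a a) \<cdot>\<^bsub>C\<^esub> (I \<boxtimes>\<^bsub>C\<^esub> \<sigma>) = \<sigma> \<cdot>\<^bsub>C\<^esub> \<mu>)"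


section \<open>Modules\<close>

text \<open>A module is a pair \<open>(x, \<rho>)\<close> with \<open>\<rho> : A \<otimes> x \<rightarrow> x\<close>.\<close>

definition left_module ::
  "('o, 'm, 'x) moncat_scheme \<Rightarrow> ('o, 'm) ring_data \<Rightarrow> 'o \<times> 'm \<Rightarrow> bool" where
  "left_module C A X \<longleftrightarrow> (let a = rob A; x = fst X; \<rho> = snd X in
     x \<in> Ob C \<and> \<rho> \<in> hom C (a \<otimes>\<^bsub>C\<^esub> x) x \<and>
     \<rho> \<cdot>\<^bsub>C\<^esub> (rmul A \<boxtimes>\<^bsub>C\<^esub> Id C x) = \<rho> \<cdot>\<^bsub>C\<^esub> (Id C a \<boxtimes>\<^bsub>C\<^esub> \<rho>) \<cdot>\<^bsub>C\<^esub> Assoc C a a x \<and>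
     \<rho> \<cdot>\<^bsub>C\<^esub> (rone A \<boxtimes>\<^bsub>C\<^esub> Id C x) = LUnit C x)"

definition linear_arr ::
  "('o, 'm, 'x) moncat_scheme \<Rightarrow> ('o, 'm) ring_data \<Rightarrow> 'o \<times> 'm \<Rightarrow> 'o \<times> 'm \<Rightarrow> 'm \<Rightarrow> bool" where
  "linear_arr C A X Y f \<longleftrightarrow>
     f \<in> hom C (fst X) (fst Y) \<and>
     f \<cdot>\<^bsub>C\<^esub> snd X = snd Y \<cdot>\<^bsub>C\<^esub> (Id C (rob A) \<boxtimes>\<^bsub>C\<^esub> f)"

definition regular_module :: "('o, 'm) ring_data \<Rightarrow> 'o \<times> 'm" where
  "regular_module A = (rob A, rmul A)"

definition indecomposable_ring :: "('o, 'm, 'x) moncat_scheme \<Rightarrow> ('o, 'm) ring_data \<Rightarrow> bool" where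
  "indecomposable_ring C A \<longleftrightarrow> ring C A \<and> \<not> zero_object C (rob A) \<and>
     (\<forall>e. linear_arr C A (regular_module A) (regular_module A) e \<and> e \<cdot>\<^bsub>C\<^esub> e = e \<longrightarrow>
        e = Id C (rob A) \<or> e = Zero C (rob A) (rob A))"

text \<open>The category of \<open>A\<close>-modules.  An arrow is a triple \<open>(X, f, Y)\<close> remembering its source
  and target modules; \<open>und\<close> returns the underlying arrow \<open>f\<close>.\<close>

type_synonym ('o, 'm) mod_arr = "('o \<times> 'm) \<times> 'm \<times> ('o \<times> 'm)"

definition und :: "('o, 'm) mod_arr \<Rightarrow> 'm" where
  "und F = fst (snd F)"

definition Mod ::
  "('o, 'm, 'x) moncat_scheme \<Rightarrow> ('o, 'm) ring_data \<Rightarrow> ('o \<times> 'm, ('o, 'm) mod_arr) addcat" where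
  "Mod C A =
     \<lparr>Ob = {X. left_module C A X},
      Arr = {(X, f, Y) | X f Y. left_module C A X \<and> left_module C A Y \<and> linear_arr C A X Y f},
      Dom = (\<lambda>(X, f, Y). X),
      Cod = (\<lambda>(X, f, Y). Y),
      Id = (\<lambda>X. (X, Id C (fst X), X)),
      Comp = (\<lambda>G F. (fst F, und G \<cdot>\<^bsub>C\<^esub> und F, snd (snd G))),
      Add = (\<lambda>F G. (fst F, und F \<oplus>\<^bsub>C\<^esub> und G, snd (snd F))),
      Zero = (\<lambda>X Y. (X, Zero C (fst X) (fst Y), Y))\<rparr>"

text \<open>The two action maps \<open>(x \<otimes> A) \<otimes> y \<rightrightarrows> x \<otimes> y\<close>.  Since \<open>A\<close> is commutative, the left module
  \<open>x\<close> is a right module through the swap.\<close>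

definition right_action ::
  "('o, 'm, 'x) moncat_scheme \<Rightarrow> ('o, 'm) ring_data \<Rightarrow> 'o \<times> 'm \<Rightarrow> 'm" where
  "right_action C A X = snd X \<cdot>\<^bsub>C\<^esub> Swap C (fst X) (rob A)"

definition act_left ::
  "('o, 'm, 'x) moncat_scheme \<Rightarrow> ('o, 'm) ring_data \<Rightarrow> 'o \<times> 'm \<Rightarrow> 'o \<times> 'm \<Rightarrow> 'm" where
  "act_left C A X Y = right_action C A X \<boxtimes>\<^bsub>C\<^esub> Id C (fst Y)"

definition act_right ::
  "('o, 'm, 'x) moncat_scheme \<Rightarrow> ('o, 'm) ring_data \<Rightarrow> 'o \<times> 'm \<Rightarrow> 'o \<times> 'm \<Rightarrow> 'm" where
  "act_right C A X Y =
     (Id C (fst X) \<boxtimes>\<^bsub>C\<^esub> snd Y) \<cdot>\<^bsub>C\<^esub> Assoc C (fst X) (rob A) (fst Y)"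

text \<open>\<open>M\<close> is the symmetric monoidal category \<open>A-Mod\<close> under \<open>\<otimes>\<^sub>A\<close>, formed with the
  coequalisers \<open>q X Y : x \<otimes> y \<rightarrow> x \<otimes>\<^sub>A y\<close>.  Coequalisers being determined only up to
  isomorphism, the choice of \<open>q\<close> is part of the data; once it is made, every ingredient of the
  monoidal structure is forced by the equations below, because the maps \<open>q\<close> (and the
  composites of the form \<open>q \<cdot> (q \<otimes> 1)\<close>) are epimorphisms when \<open>A\<close> is separable.\<close>

definition module_category ::
  "('o, 'm, 'x) moncat_scheme \<Rightarrow> ('o, 'm) ring_data \<Rightarrow>
   ('o \<times> 'm, ('o, 'm) mod_arr) moncat \<Rightarrow> ('o \<times> 'm \<Rightarrow> 'o \<times> 'm \<Rightarrow> 'm) \<Rightarrow> bool" where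
  "module_category C A M q \<longleftrightarrow>
     idempotent_complete_smc M \<and>
     addcat.truncate M = Mod C A \<and>
     \<one>\<^bsub>M\<^esub> = regular_module A \<and>
     (\<forall>X \<in> Ob M. \<forall>Y \<in> Ob M.
        coequaliser C (act_left C A X Y) (act_right C A X Y) (q X Y) \<and>
        Cod C (q X Y) = fst (X \<otimes>\<^bsub>M\<^esub> Y) \<and>
        snd (X \<otimes>\<^bsub>M\<^esub> Y) \<cdot>\<^bsub>C\<^esub> (Id C (rob A) \<boxtimes>\<^bsub>C\<^esub> q X Y) =
          q X Y \<cdot>\<^bsub>C\<^esub> (snd X \<boxtimes>\<^bsub>C\<^esub> Id C (fst Y)) \<cdot>\<^bsub>C\<^esub>
          inverse_arr C (Assoc C (rob A) (fst X) (fst Y)) \<and>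
        und (Swap M X Y) \<cdot>\<^bsub>C\<^esub> q X Y = q Y X \<cdot>\<^bsub>C\<^esub> Swap C (fst X) (fst Y)) \<and>
     (\<forall>F \<in> Arr M. \<forall>G \<in> Arr M.
        und (F \<boxtimes>\<^bsub>M\<^esub> G) \<cdot>\<^bsub>C\<^esub> q (Dom M F) (Dom M G) =
          q (Cod M F) (Cod M G) \<cdot>\<^bsub>C\<^esub> (und F \<boxtimes>\<^bsub>C\<^esub> und G)) \<and>
     (\<forall>X \<in> Ob M.
        und (LUnit M X) \<cdot>\<^bsub>C\<^esub> q \<one>\<^bsub>M\<^esub> X = snd X \<and>
        und (RUnit M X) \<cdot>\<^bsub>C\<^esub> q X \<one>\<^bsub>M\<^esub> = right_action C A X) \<and>
     (\<forall>X \<in> Ob M. \<forall>Y \<in> Ob M. \<forall>Z \<in> Ob M.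
        und (Assoc M X Y Z) \<cdot>\<^bsub>C\<^esub> q (X \<otimes>\<^bsub>M\<^esub> Y) Z \<cdot>\<^bsub>C\<^esub> (q X Y \<boxtimes>\<^bsub>C\<^esub> Id C (fst Z)) =
          q X (Y \<otimes>\<^bsub>M\<^esub> Z) \<cdot>\<^bsub>C\<^esub> (Id C (fst X) \<boxtimes>\<^bsub>C\<^esub> q Y Z) \<cdot>\<^bsub>C\<^esub>
          Assoc C (fst X) (fst Y) (fst Z))"

text \<open>A ring \<open>B\<close> in \<open>A-Mod\<close> corresponds to an \<open>A\<close>-algebra in the ambient category: the ring
  below together with the structure morphism \<open>und (rone B)\<close> from \<open>A\<close>.\<close>

definition underlying_ring ::
  "('o, 'm, 'x) moncat_scheme \<Rightarrow> ('o, 'm) ring_data \<Rightarrow> ('o \<times> 'm \<Rightarrow> 'o \<times> 'm \<Rightarrow> 'm) \<Rightarrow>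
   ('o \<times> 'm, ('o, 'm) mod_arr) ring_data \<Rightarrow> ('o, 'm) ring_data" where
  "underlying_ring C A q B =
     \<lparr>rob = fst (rob B),
      rmul = und (rmul B) \<cdot>\<^bsub>C\<^esub> q (rob B) (rob B),
      rone = und (rone B) \<cdot>\<^bsub>C\<^esub> rone A\<rparr>"


section \<open>The splitting tower and the degree\<close>

text \<open>\<open>A'\<close>, with structure morphism \<open>f : A \<rightarrow> A'\<close>, is the separable \<open>A\<close>-algebra with
  \<open>A \<otimes> A \<cong> A \<times> A'\<close>.\<close>

definition splitting_algebra ::
  "('o, 'm, 'x) moncat_scheme \<Rightarrow> ('o, 'm) ring_data \<Rightarrow> ('o, 'm) ring_data \<Rightarrow> 'm \<Rightarrow> bool" where
  "splitting_algebra C A A' f \<longleftrightarrow>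
     separable_ring C A' \<and> ring_morphism C A A' f \<and>
     (\<exists>P p\<^sub>1 p\<^sub>2 h.
        product_ring C P A A' p\<^sub>1 p\<^sub>2 \<and>
        ring_morphism C (tensor_ring C A A) P h \<and> iso_arr C h \<and>
        p\<^sub>1 \<cdot>\<^bsub>C\<^esub> h = rmul A \<and>
        p\<^sub>2 \<cdot>\<^bsub>C\<^esub> h \<cdot>\<^bsub>C\<^esub> (Id C (rob A) \<boxtimes>\<^bsub>C\<^esub> rone A) \<cdot>\<^bsub>C\<^esub> inverse_arr C (RUnit C (rob A)) = f)"

text \<open>The splitting algebra \<open>B'\<close>, with structure morphism \<open>f' : B \<rightarrow> B'\<close>, of an \<open>R\<close>-algebra
  \<open>B\<close> with structure morphism \<open>f : R \<rightarrow> B\<close>.  It is formed in \<open>R-Mod\<close>, where \<open>B\<close> and \<open>B'\<close>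
  correspond to the rings \<open>\<beta>\<close> and \<open>\<beta>'\<close>.\<close>

definition relative_splitting ::
  "('o, 'm, 'x) moncat_scheme \<Rightarrow> ('o, 'm) ring_data \<Rightarrow> ('o, 'm) ring_data \<Rightarrow> 'm \<Rightarrow>
   ('o, 'm) ring_data \<Rightarrow> 'm \<Rightarrow> bool" where
  "relative_splitting C R B f B' f' \<longleftrightarrow>
     (\<exists>M q \<beta> \<beta>' \<phi>.
        module_category C R M q \<and>
        ring M \<beta> \<and> underlying_ring C R q \<beta> = B \<and> und (rone \<beta>) = f \<and>
        splitting_algebra M \<beta> \<beta>' \<phi> \<and>
        underlying_ring C R q \<beta>' = B' \<and> und \<phi> = f')"

text \<open>\<open>T n\<close> is \<open>A\<^sup>[\<^sup>n\<^sup>]\<close> and \<open>s n : T n \<rightarrow> T (n + 1)\<close> its structure morphism as an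
  algebra over the previous stage.  Separability of \<open>T n\<close> in \<open>C\<close> is the same as its separability
  over \<open>T (n - 1)\<close>.\<close>

definition splitting_tower ::
  "('o, 'm, 'x) moncat_scheme \<Rightarrow> ('o, 'm) ring_data \<Rightarrow> (nat \<Rightarrow> ('o, 'm) ring_data) \<Rightarrow>
   (nat \<Rightarrow> 'm) \<Rightarrow> bool" where
  "splitting_tower C A T s \<longleftrightarrow>
     T 0 = unit_ring C \<and> T 1 = A \<and> s 0 = rone A \<and>
     (\<forall>n. separable_ring C (T n)) \<and>
     (\<forall>n. relative_splitting C (T n) (T (n + 1)) (s n) (T (n + 2)) (s (n + 1)))"

definition has_degree :: "('o, 'm, 'x) moncat_scheme \<Rightarrow> ('o, 'm) ring_data \<Rightarrow> nat \<Rightarrow> bool" where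
  "has_degree C A d \<longleftrightarrow>
     (\<exists>T s. splitting_tower C A T s \<and>
        \<not> zero_object C (rob (T d)) \<and> zero_object C (rob (T (d + 1))))"

text \<open>The splitting tower of a separable ring exists and is unique up to isomorphism, and its
  stages vanish from the first zero stage on, so there is at most one \<open>d\<close> as below.\<close>

definition degree :: "('o, 'm, 'x) moncat_scheme \<Rightarrow> ('o, 'm) ring_data \<Rightarrow> enat" where
  "degree C A = (if \<exists>d. has_degree C A d then enat (LEAST d. has_degree C A d) else \<infinity>)"

end

theory Submission
  imports Defs
begin

text \<open>The bound comes from counting extensions up the splitting tower.  Let \<open>T 0 = \<one>, T 1 = A, T 2, \<dots>\<close> be
  the tower of \<open>A\<close>, with structure morphisms \<open>s n : T n \<rightarrow> T (n + 1)\<close> and \<open>T (d + 1) = 0\<close>, and let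
  \<open>g : T n \<rightarrow> B\<close> be a ring morphism.  The claim is that at most \<open>d - n\<close> ring morphisms
  \<open>h : T (n + 1) \<rightarrow> B\<close> satisfy \<open>h \<cdot> s n = g\<close>.  For \<open>n = 0\<close> the condition on \<open>h\<close> only says that \<open>h\<close>
  preserves the unit, so this case is the theorem.

  For \<open>n = d\<close> there is no such \<open>h\<close>, because the zero ring does not map to a nonzero ring.  For
  \<open>n < d\<close>, fix one extension \<open>k\<close>.  Any other extension \<open>h\<close> combines with \<open>k\<close> to a ring morphism
  \<open>T (n + 1) \<otimes> T (n + 1) \<rightarrow> B\<close> sending \<open>x \<otimes> y\<close> to \<open>k(x) h(y)\<close>, the tensor product being taken over \<open>T n\<close>, and the source is
  \<open>T (n + 1) \<times> T (n + 2)\<close>.  The idempotent of the second factor maps to an idempotent of \<open>B\<close>, hence to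
  \<open>0\<close> or \<open>1\<close>, and the morphism factors through one of the two factors.  The projection to the first
  factor is the multiplication, and factoring through it would force \<open>h = k\<close>.  So the morphism
  factors through some \<open>\<psi> : T (n + 2) \<rightarrow> B\<close>, which extends \<open>k\<close>, and \<open>h = \<psi> \<cdot> w\<close> for an arrow \<open>w\<close> that
  does not depend on \<open>h\<close>.  Consequently \<open>T (n + 1)\<close> has at most one more extension of \<open>g\<close> than
  \<open>T (n + 2)\<close> has extensions of \<open>k\<close>; this is \<open>card_algebra_morphisms_le\<close>.

  The argument about the two factors (\<open>splitting_algebra_extension\<close>) is made in an arbitrary
  symmetric monoidal category and applied in the category of \<open>T n\<close>-modules.  To apply it there,
  the \<open>T n\<close>-algebra \<open>B\<close> has to be turned into a ring in that category
  (\<open>algebra_as_ring_in_modules\<close>).  The ring axioms are identities between arrows out of iterated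
  relative tensor products, so they can be checked on the ordinary tensor products provided that the
  coequalisers involved stay epimorphisms after tensoring with an object.  Separability of
  \<open>T n\<close> ensures this, because it splits those coequalisers
  (\<open>separable_coequaliser_split\<close>).\<close>

section \<open>Calculus in additive and symmetric monoidal categories\<close>

text \<open>Membership in \<open>hom\<close> is unfolded into conditions on domains and codomains.  In this form the
  side conditions of associativity and of functoriality of the tensor product mention only the
  arrows that occur in the term being rewritten, so both can serve as simplification rules.  Composites
  are normalised to the right, and consecutive tensor products of arrows are merged.\<close>

context additive_category
begin

lemma hom_iff [simp]: "f \<in> hom C x y \<longleftrightarrow> f \<in> Arr C \<and> Dom C f = x \<and> Cod C f = y"
  by (auto simp: hom_def)

lemma dom_cod_ob [simp]: "f \<in> Arr C \<Longrightarrow> Dom C f \<in> Ob C" "f \<in> Arr C \<Longrightarrow> Cod C f \<in> Ob C"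
  using arr_ob by auto

lemma id_typing [simp]: "x \<in> Ob C \<Longrightarrow> Id C x \<in> Arr C" "x \<in> Ob C \<Longrightarrow> Dom C (Id C x) = x"
    "x \<in> Ob C \<Longrightarrow> Cod C (Id C x) = x"
  using id_hom by auto

lemma zero_typing [simp]:
  assumes "x \<in> Ob C" "y \<in> Ob C"
  shows "Zero C x y \<in> Arr C" "Dom C (Zero C x y) = x" "Cod C (Zero C x y) = y"
  using zero_hom[OF assms] by auto

lemma comp_typing [simp]:
  assumes "f \<in> Arr C" "g \<in> Arr C" "Dom C g = Cod C f"
  shows "g \<cdot> f \<in> Arr C" "Dom C (g \<cdot> f) = Dom C f" "Cod C (g \<cdot> f) = Cod C g"
  using comp_hom[of f "Dom C f" "Cod C f" g "Cod C g"] assms by auto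

lemma id_laws [simp]:
  "f \<in> Arr C \<Longrightarrow> Dom C f = x \<Longrightarrow> f \<cdot> Id C x = f"
  "f \<in> Arr C \<Longrightarrow> Cod C f = x \<Longrightarrow> Id C x \<cdot> f = f"
  using comp_id[of f x "Cod C f"] id_comp[of f "Dom C f" x] by auto

lemma comp_assoc' [simp]:
  assumes "f \<in> Arr C" "g \<in> Arr C" "h \<in> Arr C" "Dom C g = Cod C f" "Dom C h = Cod C g"
  shows "(h \<cdot> g) \<cdot> f = h \<cdot> (g \<cdot> f)"
  using comp_assoc[of f "Dom C f" "Cod C f" g "Cod C g" h "Cod C h"] assms by auto

lemma add_cancel_self:
  assumes "f \<in> hom C x y" "f \<oplus> f = f"
  shows "f = Zero C x y"
proof -
  obtain g where g: "g \<in> hom C x y" "f \<oplus> g = Zero C x y" using add_inverse assms by blast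
  have "f \<oplus> (f \<oplus> g) = f \<oplus> g" using add_assoc[OF assms(1) assms(1) g(1)] assms(2) by simp
  then show ?thesis using g add_zero[OF assms(1)] by simp
qed

lemma comp_zero [simp]:
  assumes "f \<in> Arr C" "x \<in> Ob C" "Dom C f = y"
  shows "f \<cdot> Zero C x y = Zero C x (Cod C f)"
proof (rule add_cancel_self)
  have y: "y \<in> Ob C" using assms by auto
  show "f \<cdot> Zero C x y \<in> hom C x (Cod C f)" using assms y by simp
  show "(f \<cdot> Zero C x y) \<oplus> (f \<cdot> Zero C x y) = f \<cdot> Zero C x y"
    using comp_add_right[of "Zero C x y" x y "Zero C x y" f "Cod C f"]
      add_zero[of "Zero C x y" x y] assms y by simp
qed

lemma zero_comp [simp]:
  assumes "f \<in> Arr C" "y \<in> Ob C" "Cod C f = x"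
  shows "Zero C x y \<cdot> f = Zero C (Dom C f) y"
proof (rule add_cancel_self)
  have x: "x \<in> Ob C" using assms by auto
  show "Zero C x y \<cdot> f \<in> hom C (Dom C f) y" using assms x by simp
  show "(Zero C x y \<cdot> f) \<oplus> (Zero C x y \<cdot> f) = Zero C x y \<cdot> f"
    using comp_add_left[of f "Dom C f" x "Zero C x y" y "Zero C x y"]
      add_zero[of "Zero C x y" x y] assms x by simp
qed

lemma zero_object_if_id_zero:
  assumes "x \<in> Ob C" "Id C x = Zero C x x"
  shows "zero_object C x"
  unfolding zero_object_def
proof (intro conjI ballI)
  fix y assume y: "y \<in> Ob C"
  have "f = Zero C x y" if "f \<in> hom C x y" for f
    using that comp_id[OF that] comp_zero[of f x x] assms by simp
  then show "\<exists>!f. f \<in> hom C x y" using zero_hom[OF assms(1) y] by blast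
  have "f = Zero C y x" if "f \<in> hom C y x" for f
    using that id_comp[OF that] zero_comp[of f x x] assms by simp
  then show "\<exists>!f. f \<in> hom C y x" using zero_hom[OF y assms(1)] by blast
qed (rule assms)

lemma inverse_arr_props:
  assumes "iso_arr C f"
  shows "inverse_arr C f \<in> hom C (Cod C f) (Dom C f)"
    and "inverse_arr C f \<cdot> f = Id C (Dom C f)"
    and "f \<cdot> inverse_arr C f = Id C (Cod C f)"
proof -
  let ?P = "\<lambda>g. g \<in> hom C (Cod C f) (Dom C f) \<and> g \<cdot> f = Id C (Dom C f) \<and> f \<cdot> g = Id C (Cod C f)"
  have f: "f \<in> Arr C" and ex: "\<exists>g. ?P g" using assms by (auto simp: iso_arr_def)
  have uniq: "g = g'" if "?P g" "?P g'" for g g'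
  proof -
    have "g = g \<cdot> (f \<cdot> g')" using that(1) conjunct2[OF conjunct2[OF that(2)]] f by simp
    also have "\<dots> = (g \<cdot> f) \<cdot> g'"
      using that(1) that(2)[THEN conjunct1] f comp_assoc'[of g' f g] by (simp del: comp_assoc')
    also have "\<dots> = g'"
      using that(1)[THEN conjunct2, THEN conjunct1] that(2)[THEN conjunct1] f
      by (simp del: comp_assoc')
    finally show ?thesis .
  qed
  have "\<exists>!g. ?P g" using ex uniq by blast
  then have "?P (THE g. ?P g)" by (rule theI')
  then show "inverse_arr C f \<in> hom C (Cod C f) (Dom C f)"
    and "inverse_arr C f \<cdot> f = Id C (Dom C f)"
    and "f \<cdot> inverse_arr C f = Id C (Cod C f)"
    unfolding inverse_arr_def by blast+
qed

lemma inverse_arr_laws [simp]: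
  assumes "iso_arr C f"
  shows "inverse_arr C f \<in> Arr C" "Dom C (inverse_arr C f) = Cod C f"
    "Cod C (inverse_arr C f) = Dom C f"
    "inverse_arr C f \<cdot> f = Id C (Dom C f)" "f \<cdot> inverse_arr C f = Id C (Cod C f)"
  using inverse_arr_props[OF assms] by auto

lemma inverse_arr_cancel [simp]:
  assumes "iso_arr C f" "h \<in> Arr C"
  shows "Cod C h = Dom C f \<Longrightarrow> inverse_arr C f \<cdot> (f \<cdot> h) = h"
    and "Cod C h = Cod C f \<Longrightarrow> f \<cdot> (inverse_arr C f \<cdot> h) = h"
proof -
  have f: "f \<in> Arr C" using assms by (simp add: iso_arr_def)
  show "inverse_arr C f \<cdot> (f \<cdot> h) = h" if "Cod C h = Dom C f"
    using comp_assoc'[of h f "inverse_arr C f"] f assms that by simp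
  show "f \<cdot> (inverse_arr C f \<cdot> h) = h" if "Cod C h = Cod C f"
    using comp_assoc'[of h "inverse_arr C f" f] f assms that by simp
qed

lemma iso_epi:
  assumes "iso_arr C f" "g \<in> Arr C" "g' \<in> Arr C" "Dom C g = Cod C f" "Dom C g' = Cod C f"
    "g \<cdot> f = g' \<cdot> f"
  shows "g = g'"
proof -
  have f: "f \<in> Arr C" using assms by (simp add: iso_arr_def)
  have "g = (g \<cdot> f) \<cdot> inverse_arr C f" using assms(1-5) f by simp
  also have "\<dots> = (g' \<cdot> f) \<cdot> inverse_arr C f" by (simp only: assms(6))
  also have "\<dots> = g'" using assms(1-5) f by simp
  finally show ?thesis .
qed

lemma iso_mono:
  assumes "iso_arr C f" "g \<in> Arr C" "g' \<in> Arr C" "Cod C g = Dom C f" "Cod C g' = Dom C f"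
    "f \<cdot> g = f \<cdot> g'"
  shows "g = g'"
proof -
  have "g = inverse_arr C f \<cdot> (f \<cdot> g)" using assms(1-5) by simp
  also have "\<dots> = inverse_arr C f \<cdot> (f \<cdot> g')" by (simp only: assms(6))
  also have "\<dots> = g'" using assms(1-5) by simp
  finally show ?thesis .
qed

lemma comp_rewrite:
  assumes "g \<cdot> f = k" "f \<in> Arr C" "g \<in> Arr C" "Dom C g = Cod C f" "h \<in> Arr C" "Cod C h = Dom C f"
  shows "g \<cdot> (f \<cdot> h) = k \<cdot> h"
  using comp_assoc'[of h f g] assms by simp

lemma biproduct_joint_mono:
  assumes "biproduct C s x y i1 i2 p1 p2" "u \<in> Arr C" "v \<in> Arr C" "Cod C u = s" "Cod C v = s"
    "p1 \<cdot> u = p1 \<cdot> v" "p2 \<cdot> u = p2 \<cdot> v"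
  shows "u = v"
proof -
  have t: "i1 \<in> hom C x s" "i2 \<in> hom C y s" "p1 \<in> hom C s x" "p2 \<in> hom C s y"
    and sum: "(i1 \<cdot> p1) \<oplus> (i2 \<cdot> p2) = Id C s"
    using assms(1) by (simp_all only: biproduct_def)
  have "w = (i1 \<cdot> (p1 \<cdot> w)) \<oplus> (i2 \<cdot> (p2 \<cdot> w))" if "w \<in> Arr C" "Cod C w = s" for w
  proof -
    have "w = ((i1 \<cdot> p1) \<oplus> (i2 \<cdot> p2)) \<cdot> w" using that by (simp only: sum) simp
    also have "\<dots> = ((i1 \<cdot> p1) \<cdot> w) \<oplus> ((i2 \<cdot> p2) \<cdot> w)"
      by (rule comp_add_left[of _ "Dom C w" s _ s]) (use t that in simp_all)
    finally show ?thesis using t that by simp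
  qed
  from this[of u] this[of v] show ?thesis using assms(2-7) by simp
qed

lemma coequaliser_factor:
  assumes "coequaliser C f g q" "h \<in> Arr C" "Dom C h = Cod C f" "h \<cdot> f = h \<cdot> g"
  obtains k where "k \<in> hom C (Cod C q) (Cod C h)" "k \<cdot> q = h"
  using assms unfolding coequaliser_def by blast

lemma coequaliser_epi:
  assumes "coequaliser C f g q" "u \<in> Arr C" "v \<in> Arr C" "Dom C u = Cod C q" "Dom C v = Cod C q"
    "u \<cdot> q = v \<cdot> q"
  shows "u = v"
proof -
  have t: "f \<in> Arr C" "g \<in> Arr C" "Dom C g = Dom C f" "Cod C g = Cod C f" "q \<in> Arr C"
      "Dom C q = Cod C f" "q \<cdot> f = q \<cdot> g"
    using assms(1) by (auto simp: coequaliser_def)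
  have c: "Cod C u = Cod C v"
    using arg_cong[OF assms(6), of "Cod C"] assms(1-5) t by simp
  have "(u \<cdot> q) \<cdot> f = (u \<cdot> q) \<cdot> g" using assms(2-5) t by simp
  moreover have "u \<cdot> q \<in> Arr C" "Dom C (u \<cdot> q) = Cod C f" "Cod C (u \<cdot> q) = Cod C u"
    using assms(2-5) t by simp_all
  ultimately have ex1: "\<exists>!k. k \<in> hom C (Cod C q) (Cod C u) \<and> k \<cdot> q = u \<cdot> q"
    using assms(1) unfolding coequaliser_def by metis
  have "u \<in> hom C (Cod C q) (Cod C u)" "v \<in> hom C (Cod C q) (Cod C u)"
    using assms(2-5) c by simp_all
  then show ?thesis using ex1 assms(6) by metis
qed

end

context symmetric_monoidal_category
begin

lemma unit_ob' [simp]: "\<one> \<in> Ob C" by (rule unit_ob)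

lemma tens_ob' [simp]: "x \<in> Ob C \<Longrightarrow> y \<in> Ob C \<Longrightarrow> x \<otimes> y \<in> Ob C" by (rule tens_ob)

lemma tens_typing [simp]:
  assumes "f \<in> Arr C" "g \<in> Arr C"
  shows "f \<boxtimes> g \<in> Arr C" "Dom C (f \<boxtimes> g) = Dom C f \<otimes> Dom C g" "Cod C (f \<boxtimes> g) = Cod C f \<otimes> Cod C g"
  using tens_hom[of f "Dom C f" "Cod C f" g "Dom C g" "Cod C g"] assms by auto

lemma tens_id' [simp]: "x \<in> Ob C \<Longrightarrow> y \<in> Ob C \<Longrightarrow> Id C x \<boxtimes> Id C y = Id C (x \<otimes> y)"
  by (rule tens_id)

lemma tens_comp' [simp]:
  assumes "f \<in> Arr C" "f' \<in> Arr C" "g \<in> Arr C" "g' \<in> Arr C" "Dom C f' = Cod C f" "Dom C g' = Cod C g"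
  shows "(f' \<boxtimes> g') \<cdot> (f \<boxtimes> g) = (f' \<cdot> f) \<boxtimes> (g' \<cdot> g)"
  using tens_comp[of f "Dom C f" "Cod C f" f' "Cod C f'" g "Dom C g" "Cod C g" g' "Cod C g'"] assms
  by auto

lemma tens_comp_chain [simp]:
  assumes "f \<in> Arr C" "f' \<in> Arr C" "g \<in> Arr C" "g' \<in> Arr C" "Dom C f' = Cod C f" "Dom C g' = Cod C g"
    "h \<in> Arr C" "Cod C h = Dom C f \<otimes> Dom C g"
  shows "(f' \<boxtimes> g') \<cdot> ((f \<boxtimes> g) \<cdot> h) = ((f' \<cdot> f) \<boxtimes> (g' \<cdot> g)) \<cdot> h"
  using comp_assoc'[of h "f \<boxtimes> g" "f' \<boxtimes> g'"] assms by simp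

lemma structure_typing [simp]:
  "x \<in> Ob C \<Longrightarrow> LUnit C x \<in> Arr C" "x \<in> Ob C \<Longrightarrow> Dom C (LUnit C x) = \<one> \<otimes> x" "x \<in> Ob C \<Longrightarrow> Cod C (LUnit C x) = x"
  "x \<in> Ob C \<Longrightarrow> RUnit C x \<in> Arr C" "x \<in> Ob C \<Longrightarrow> Dom C (RUnit C x) = x \<otimes> \<one>" "x \<in> Ob C \<Longrightarrow> Cod C (RUnit C x) = x"
  "x \<in> Ob C \<Longrightarrow> y \<in> Ob C \<Longrightarrow> Swap C x y \<in> Arr C"
  "x \<in> Ob C \<Longrightarrow> y \<in> Ob C \<Longrightarrow> Dom C (Swap C x y) = x \<otimes> y"
  "x \<in> Ob C \<Longrightarrow> y \<in> Ob C \<Longrightarrow> Cod C (Swap C x y) = y \<otimes> x"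
  "x \<in> Ob C \<Longrightarrow> y \<in> Ob C \<Longrightarrow> z \<in> Ob C \<Longrightarrow> Assoc C x y z \<in> Arr C"
  "x \<in> Ob C \<Longrightarrow> y \<in> Ob C \<Longrightarrow> z \<in> Ob C \<Longrightarrow> Dom C (Assoc C x y z) = (x \<otimes> y) \<otimes> z"
  "x \<in> Ob C \<Longrightarrow> y \<in> Ob C \<Longrightarrow> z \<in> Ob C \<Longrightarrow> Cod C (Assoc C x y z) = x \<otimes> (y \<otimes> z)"
  using lunit_hom[of x] runit_hom[of x] swap_hom[of x y] assoc_hom[of x y z] by simp_all

lemma structure_iso [simp]:
  "x \<in> Ob C \<Longrightarrow> iso_arr C (LUnit C x)" "x \<in> Ob C \<Longrightarrow> iso_arr C (RUnit C x)"
  "x \<in> Ob C \<Longrightarrow> y \<in> Ob C \<Longrightarrow> z \<in> Ob C \<Longrightarrow> iso_arr C (Assoc C x y z)"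
  by (simp_all add: lunit_iso runit_iso assoc_iso)

lemma iso_tens:
  assumes "iso_arr C f" "iso_arr C g"
  shows "iso_arr C (f \<boxtimes> g)"
proof -
  have "f \<in> Arr C" "g \<in> Arr C" using assms by (auto simp: iso_arr_def)
  then show ?thesis unfolding iso_arr_def using assms
    by (intro conjI bexI[of _ "inverse_arr C f \<boxtimes> inverse_arr C g"]) simp_all
qed

lemma iso_id: "x \<in> Ob C \<Longrightarrow> iso_arr C (Id C x)"
  unfolding iso_arr_def by (intro conjI bexI[of _ "Id C x"]) simp_all

lemma assoc_nat:
  assumes "f \<in> Arr C" "g \<in> Arr C" "h \<in> Arr C" "Cod C f = x" "Cod C g = y" "Cod C h = z"
  shows "Assoc C x y z \<cdot> ((f \<boxtimes> g) \<boxtimes> h) = (f \<boxtimes> (g \<boxtimes> h)) \<cdot> Assoc C (Dom C f) (Dom C g) (Dom C h)"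
  using assoc_natural[of f "Dom C f" x g "Dom C g" y h "Dom C h" z] assms by simp

lemma assoc_nat_chain:
  assumes "f \<in> Arr C" "g \<in> Arr C" "h \<in> Arr C" "Cod C f = x" "Cod C g = y" "Cod C h = z"
    "k \<in> Arr C" "Cod C k = (Dom C f \<otimes> Dom C g) \<otimes> Dom C h"
  shows "Assoc C x y z \<cdot> (((f \<boxtimes> g) \<boxtimes> h) \<cdot> k) =
    (f \<boxtimes> (g \<boxtimes> h)) \<cdot> (Assoc C (Dom C f) (Dom C g) (Dom C h) \<cdot> k)"
proof -
  have "Cod C f \<in> Ob C" "Cod C g \<in> Ob C" "Cod C h \<in> Ob C" using assms by auto
  then show ?thesis
    using comp_rewrite[OF assoc_nat[OF assms(1-6)], of k] assms by simp
qed

lemma assoc_inv_nat: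
  assumes "f \<in> Arr C" "g \<in> Arr C" "h \<in> Arr C" "Cod C f = x" "Cod C g = y" "Cod C h = z"
  shows "inverse_arr C (Assoc C x y z) \<cdot> (f \<boxtimes> (g \<boxtimes> h)) =
    ((f \<boxtimes> g) \<boxtimes> h) \<cdot> inverse_arr C (Assoc C (Dom C f) (Dom C g) (Dom C h))"
proof -
  have o: "x \<in> Ob C" "y \<in> Ob C" "z \<in> Ob C" using assms by auto
  have "Assoc C x y z \<cdot> (((f \<boxtimes> g) \<boxtimes> h) \<cdot> inverse_arr C (Assoc C (Dom C f) (Dom C g) (Dom C h)))
      = f \<boxtimes> (g \<boxtimes> h)"
    using assms o by (subst assoc_nat_chain) simp_all
  then show ?thesis using assms o
      inverse_arr_cancel(1)[of "Assoc C x y z" "((f \<boxtimes> g) \<boxtimes> h) \<cdot> inverse_arr C (Assoc C (Dom C f) (Dom C g) (Dom C h))"]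
    by simp
qed

lemma assoc_inv_nat_chain:
  assumes "f \<in> Arr C" "g \<in> Arr C" "h \<in> Arr C" "Cod C f = x" "Cod C g = y" "Cod C h = z"
    "k \<in> Arr C" "Cod C k = Dom C f \<otimes> (Dom C g \<otimes> Dom C h)"
  shows "inverse_arr C (Assoc C x y z) \<cdot> ((f \<boxtimes> (g \<boxtimes> h)) \<cdot> k) =
    ((f \<boxtimes> g) \<boxtimes> h) \<cdot> (inverse_arr C (Assoc C (Dom C f) (Dom C g) (Dom C h)) \<cdot> k)"
proof -
  have "Cod C f \<in> Ob C" "Cod C g \<in> Ob C" "Cod C h \<in> Ob C" using assms by auto
  then show ?thesis
    using comp_rewrite[OF assoc_inv_nat[OF assms(1-6)], of k] assms by simp
qed

lemma lunit_nat:
  "f \<in> Arr C \<Longrightarrow> Cod C f = x \<Longrightarrow> LUnit C x \<cdot> (Id C \<one> \<boxtimes> f) = f \<cdot> LUnit C (Dom C f)"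
  using lunit_natural[of f "Dom C f" x] by simp

lemma runit_nat:
  "f \<in> Arr C \<Longrightarrow> Cod C f = x \<Longrightarrow> RUnit C x \<cdot> (f \<boxtimes> Id C \<one>) = f \<cdot> RUnit C (Dom C f)"
  using runit_natural[of f "Dom C f" x] by simp

lemma swap_nat:
  "f \<in> Arr C \<Longrightarrow> g \<in> Arr C \<Longrightarrow> Cod C f = x \<Longrightarrow> Cod C g = y \<Longrightarrow>
   Swap C x y \<cdot> (f \<boxtimes> g) = (g \<boxtimes> f) \<cdot> Swap C (Dom C f) (Dom C g)"
  using swap_natural[of f "Dom C f" x g "Dom C g" y] by simp

lemma tens_zero_right:
  assumes "f \<in> Arr C" "x \<in> Ob C" "y \<in> Ob C"
  shows "f \<boxtimes> Zero C x y = Zero C (Dom C f \<otimes> x) (Cod C f \<otimes> y)"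
proof (rule add_cancel_self)
  show "f \<boxtimes> Zero C x y \<in> hom C (Dom C f \<otimes> x) (Cod C f \<otimes> y)" using assms by simp
  show "(f \<boxtimes> Zero C x y) \<oplus> (f \<boxtimes> Zero C x y) = f \<boxtimes> Zero C x y"
    using tens_add_right[of f "Dom C f" "Cod C f" "Zero C x y" x y "Zero C x y"]
      add_zero[of "Zero C x y" x y] assms by simp
qed

lemma tens_zero_left:
  assumes "f \<in> Arr C" "x \<in> Ob C" "y \<in> Ob C"
  shows "Zero C x y \<boxtimes> f = Zero C (x \<otimes> Dom C f) (y \<otimes> Cod C f)"
proof (rule add_cancel_self)
  show "Zero C x y \<boxtimes> f \<in> hom C (x \<otimes> Dom C f) (y \<otimes> Cod C f)" using assms by simp
  show "(Zero C x y \<boxtimes> f) \<oplus> (Zero C x y \<boxtimes> f) = Zero C x y \<boxtimes> f"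
    using tens_add_left[of "Zero C x y" x y "Zero C x y" f "Dom C f" "Cod C f"]
      add_zero[of "Zero C x y" x y] assms by simp
qed

text \<open>The right unitor is a natural isomorphism between \<open>- \<otimes> \<one>\<close> and the identity functor.\<close>

lemma unit_tens_faithful:
  assumes "f \<in> Arr C" "g \<in> Arr C" "Dom C g = Dom C f" "Cod C g = Cod C f"
    "f \<boxtimes> Id C \<one> = g \<boxtimes> Id C \<one>"
  shows "f = g"
proof (rule iso_epi)
  show "iso_arr C (RUnit C (Dom C f))" using assms by simp
  show "f \<cdot> RUnit C (Dom C f) = g \<cdot> RUnit C (Dom C f)"
    using runit_nat[of f "Cod C f"] runit_nat[of g "Cod C f"] assms by simp
qed (use assms in simp_all)

text \<open>Kelly's coherence identity, a consequence of the pentagon for \<open>x, y, \<one>, \<one>\<close> and two triangles,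
  after cancelling the associator and using that \<open>- \<otimes> \<one>\<close> is faithful.\<close>

lemma runit_tens:
  assumes "x \<in> Ob C" "y \<in> Ob C"
  shows "(Id C x \<boxtimes> RUnit C y) \<cdot> Assoc C x y \<one> = RUnit C (x \<otimes> y)"
proof (rule unit_tens_faithful)
  let ?a = "Assoc C x y \<one>"
  have "?a \<cdot> ((RUnit C (x \<otimes> y)) \<boxtimes> Id C \<one>) = ?a \<cdot> ((Id C (x \<otimes> y) \<boxtimes> LUnit C \<one>) \<cdot> Assoc C (x \<otimes> y) \<one> \<one>)"
    using triangle[of "x \<otimes> y" \<one>] assms by simp
  also have "\<dots> = (Id C x \<boxtimes> (Id C y \<boxtimes> LUnit C \<one>)) \<cdot> (Assoc C x y (\<one> \<otimes> \<one>) \<cdot> Assoc C (x \<otimes> y) \<one> \<one>)"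
    using assoc_nat_chain[of "Id C x" "Id C y" "LUnit C \<one>" x y \<one> "Assoc C (x \<otimes> y) \<one> \<one>"] assms by simp
  also have "\<dots> = (Id C x \<boxtimes> (Id C y \<boxtimes> LUnit C \<one>)) \<cdot> ((Id C x \<boxtimes> Assoc C y \<one> \<one>) \<cdot> Assoc C x (y \<otimes> \<one>) \<one> \<cdot> (?a \<boxtimes> Id C \<one>))"
    using pentagon[of x y \<one> \<one>] assms by simp
  also have "\<dots> = (Id C x \<boxtimes> (RUnit C y \<boxtimes> Id C \<one>)) \<cdot> (Assoc C x (y \<otimes> \<one>) \<one> \<cdot> (?a \<boxtimes> Id C \<one>))"
    using triangle[of y \<one>] assms by simp
  also have "\<dots> = ?a \<cdot> (((Id C x \<boxtimes> RUnit C y) \<cdot> ?a) \<boxtimes> Id C \<one>)"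
    using assoc_nat_chain[of "Id C x" "RUnit C y" "Id C \<one>" x y \<one> "?a \<boxtimes> Id C \<one>"] assms by simp
  finally have e: "?a \<cdot> ((RUnit C (x \<otimes> y)) \<boxtimes> Id C \<one>) = ?a \<cdot> (((Id C x \<boxtimes> RUnit C y) \<cdot> ?a) \<boxtimes> Id C \<one>)" .
  show "((Id C x \<boxtimes> RUnit C y) \<cdot> ?a) \<boxtimes> Id C \<one> = RUnit C (x \<otimes> y) \<boxtimes> Id C \<one>"
    by (rule iso_mono[OF _ _ _ _ _ e[symmetric]]) (use assms in simp_all)
qed (use assms in simp_all)

end

context symmetric_monoidal_category
begin

section \<open>Commutative rings\<close>

lemma ring_typing [simp]:
  assumes "ring C A"
  shows "rob A \<in> Ob C" "rmul A \<in> Arr C" "Dom C (rmul A) = rob A \<otimes> rob A" "Cod C (rmul A) = rob A"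
    "rone A \<in> Arr C" "Dom C (rone A) = \<one>" "Cod C (rone A) = rob A"
  using assms by (simp_all add: ring_def Let_def)

lemma ring_laws:
  assumes "ring C A"
  shows "rmul A \<cdot> (rmul A \<boxtimes> Id C (rob A)) =
      rmul A \<cdot> ((Id C (rob A) \<boxtimes> rmul A) \<cdot> Assoc C (rob A) (rob A) (rob A))"
    and "rmul A \<cdot> Swap C (rob A) (rob A) = rmul A"
    and "rmul A \<cdot> (rone A \<boxtimes> Id C (rob A)) = LUnit C (rob A)"
    and "rmul A \<cdot> (Id C (rob A) \<boxtimes> rone A) = RUnit C (rob A)"
  using assms unfolding ring_def Let_def by blast+

lemma ring_morphism_typing:
  assumes "ring_morphism C A B f"
  shows "f \<in> Arr C" "Dom C f = rob A" "Cod C f = rob B"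
  using assms by (simp_all add: ring_morphism_def)

lemma ring_morphism_laws:
  assumes "ring_morphism C A B f"
  shows "f \<cdot> rmul A = rmul B \<cdot> (f \<boxtimes> f)" "f \<cdot> rone A = rone B"
  using assms unfolding ring_morphism_def by blast+

text \<open>The ring axioms in the form used for calculating with products \<open>\<mu> \<cdot> (f \<boxtimes> g)\<close> of arrows into a ring.\<close>

lemma mult_assoc:
  assumes "ring C B" "f \<in> hom C x (rob B)" "g \<in> hom C y (rob B)" "h \<in> hom C z (rob B)"
  shows "rmul B \<cdot> ((rmul B \<cdot> (f \<boxtimes> g)) \<boxtimes> h) =
    rmul B \<cdot> ((f \<boxtimes> (rmul B \<cdot> (g \<boxtimes> h))) \<cdot> Assoc C x y z)"
proof -
  have xyz: "x \<in> Ob C" "y \<in> Ob C" "z \<in> Ob C" using assms(2-4) by auto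
  have "rmul B \<cdot> ((rmul B \<cdot> (f \<boxtimes> g)) \<boxtimes> h)
      = (rmul B \<cdot> (rmul B \<boxtimes> Id C (rob B))) \<cdot> ((f \<boxtimes> g) \<boxtimes> h)"
    using assms by simp
  also have "\<dots> = (rmul B \<cdot> ((Id C (rob B) \<boxtimes> rmul B) \<cdot> Assoc C (rob B) (rob B) (rob B)))
      \<cdot> ((f \<boxtimes> g) \<boxtimes> h)"
    by (simp only: ring_laws(1)[OF assms(1)])
  also have "\<dots> = rmul B \<cdot> ((f \<boxtimes> (rmul B \<cdot> (g \<boxtimes> h))) \<cdot> Assoc C x y z)"
    using assms xyz by (simp add: assoc_nat)
  finally show ?thesis .
qed

lemma mult_swap:
  assumes "ring C B" "f \<in> hom C x (rob B)" "g \<in> hom C y (rob B)"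
  shows "rmul B \<cdot> ((g \<boxtimes> f) \<cdot> Swap C x y) = rmul B \<cdot> (f \<boxtimes> g)"
proof -
  have xy: "x \<in> Ob C" "y \<in> Ob C" using assms(2,3) by auto
  have "rmul B \<cdot> ((g \<boxtimes> f) \<cdot> Swap C x y) = (rmul B \<cdot> Swap C (rob B) (rob B)) \<cdot> (f \<boxtimes> g)"
    using assms xy by (simp add: swap_nat)
  then show ?thesis by (simp only: ring_laws(2)[OF assms(1)])
qed

lemma mult_one:
  assumes "ring C B" "f \<in> hom C x (rob B)"
  shows "rmul B \<cdot> (rone B \<boxtimes> f) = f \<cdot> LUnit C x" "rmul B \<cdot> (f \<boxtimes> rone B) = f \<cdot> RUnit C x"
proof -
  have x: "x \<in> Ob C" using assms(2) by auto
  have "rmul B \<cdot> (rone B \<boxtimes> f) = (rmul B \<cdot> (rone B \<boxtimes> Id C (rob B))) \<cdot> (Id C \<one> \<boxtimes> f)"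
    using assms x by simp
  then show "rmul B \<cdot> (rone B \<boxtimes> f) = f \<cdot> LUnit C x"
    using assms lunit_nat[of f "rob B"] by (simp only: ring_laws(3)[OF assms(1)]) simp
  have "rmul B \<cdot> (f \<boxtimes> rone B) = (rmul B \<cdot> (Id C (rob B) \<boxtimes> rone B)) \<cdot> (f \<boxtimes> Id C \<one>)"
    using assms x by simp
  then show "rmul B \<cdot> (f \<boxtimes> rone B) = f \<cdot> RUnit C x"
    using assms runit_nat[of f "rob B"] by (simp only: ring_laws(4)[OF assms(1)]) simp
qed

lemma middle_swap_typing [simp]:
  assumes "w \<in> Ob C" "x \<in> Ob C" "y \<in> Ob C" "z \<in> Ob C"
  shows "middle_swap C w x y z \<in> Arr C"
    "Dom C (middle_swap C w x y z) = (w \<otimes> x) \<otimes> (y \<otimes> z)"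
    "Cod C (middle_swap C w x y z) = (w \<otimes> y) \<otimes> (x \<otimes> z)"
  using assms by (simp_all add: middle_swap_def)

text \<open>Commutativity in the form \<open>(pr)(qs) = (pq)(rs)\<close>.  After reassociating to \<open>p(r(qs))\<close>, the middle
  swap acts only on the inner factor \<open>r(qs)\<close>, which becomes \<open>q(rs)\<close> by associativity and commutativity.\<close>

lemma mult_middle_swap:
  assumes B: "ring C B" and p: "p \<in> hom C w (rob B)" and q: "q \<in> hom C x (rob B)"
    and r: "r \<in> hom C y (rob B)" and s: "s \<in> hom C z (rob B)"
  shows "rmul B \<cdot> (((rmul B \<cdot> (p \<boxtimes> r)) \<boxtimes> (rmul B \<cdot> (q \<boxtimes> s))) \<cdot> middle_swap C w x y z) =
    rmul B \<cdot> ((rmul B \<cdot> (p \<boxtimes> q)) \<boxtimes> (rmul B \<cdot> (r \<boxtimes> s)))"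
proof -
  let ?m = "rmul B"
  let ?Y = "Assoc C y x z \<cdot> ((Swap C x y \<boxtimes> Id C z) \<cdot> inverse_arr C (Assoc C x y z))"
  have o: "w \<in> Ob C" "x \<in> Ob C" "y \<in> Ob C" "z \<in> Ob C" using p q r s by auto
  note t = B p q r s o
  have "(?m \<cdot> (r \<boxtimes> (?m \<cdot> (q \<boxtimes> s)))) \<cdot> ?Y
      = (?m \<cdot> ((r \<boxtimes> (?m \<cdot> (q \<boxtimes> s))) \<cdot> Assoc C y x z)) \<cdot> ((Swap C x y \<boxtimes> Id C z) \<cdot> inverse_arr C (Assoc C x y z))"
    using t by simp
  also have "\<dots> = (?m \<cdot> ((?m \<cdot> (r \<boxtimes> q)) \<boxtimes> s)) \<cdot> ((Swap C x y \<boxtimes> Id C z) \<cdot> inverse_arr C (Assoc C x y z))"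
    by (simp only: mult_assoc[OF B r q s])
  also have "\<dots> = (?m \<cdot> ((?m \<cdot> ((r \<boxtimes> q) \<cdot> Swap C x y)) \<boxtimes> s)) \<cdot> inverse_arr C (Assoc C x y z)"
    using t by simp
  also have "\<dots> = (?m \<cdot> ((?m \<cdot> (q \<boxtimes> r)) \<boxtimes> s)) \<cdot> inverse_arr C (Assoc C x y z)"
    by (simp only: mult_swap[OF B q r])
  also have "\<dots> = (?m \<cdot> ((q \<boxtimes> (?m \<cdot> (r \<boxtimes> s))) \<cdot> Assoc C x y z)) \<cdot> inverse_arr C (Assoc C x y z)"
    by (simp only: mult_assoc[OF B q r s])
  also have "\<dots> = ?m \<cdot> (q \<boxtimes> (?m \<cdot> (r \<boxtimes> s)))"
    using t by simp
  finally have Y: "(?m \<cdot> (r \<boxtimes> (?m \<cdot> (q \<boxtimes> s)))) \<cdot> ?Y = ?m \<cdot> (q \<boxtimes> (?m \<cdot> (r \<boxtimes> s)))" .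
  have qs: "?m \<cdot> (q \<boxtimes> s) \<in> hom C (x \<otimes> z) (rob B)" and rs: "?m \<cdot> (r \<boxtimes> s) \<in> hom C (y \<otimes> z) (rob B)"
    using t by simp_all
  have "?m \<cdot> (((?m \<cdot> (p \<boxtimes> r)) \<boxtimes> (?m \<cdot> (q \<boxtimes> s))) \<cdot> middle_swap C w x y z)
     = (?m \<cdot> ((?m \<cdot> (p \<boxtimes> r)) \<boxtimes> (?m \<cdot> (q \<boxtimes> s)))) \<cdot> middle_swap C w x y z"
    using t by simp
  also have "\<dots> = (?m \<cdot> ((p \<boxtimes> (?m \<cdot> (r \<boxtimes> (?m \<cdot> (q \<boxtimes> s))))) \<cdot> Assoc C w y (x \<otimes> z))) \<cdot> middle_swap C w x y z"
    by (simp only: mult_assoc[OF B p r qs])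
  also have "\<dots> = ?m \<cdot> ((p \<boxtimes> ((?m \<cdot> (r \<boxtimes> (?m \<cdot> (q \<boxtimes> s)))) \<cdot> ?Y)) \<cdot> Assoc C w x (y \<otimes> z))"
    unfolding middle_swap_def using t by simp
  also have "\<dots> = ?m \<cdot> ((p \<boxtimes> (?m \<cdot> (q \<boxtimes> (?m \<cdot> (r \<boxtimes> s))))) \<cdot> Assoc C w x (y \<otimes> z))"
    by (simp only: Y)
  also have "\<dots> = ?m \<cdot> ((?m \<cdot> (p \<boxtimes> q)) \<boxtimes> (?m \<cdot> (r \<boxtimes> s)))"
    by (simp only: mult_assoc[OF B p q rs])
  finally show ?thesis .
qed

section \<open>Ring morphisms out of tensor products and products\<close>

lemma tensor_ring_typing [simp]:
  assumes "ring C A" "ring C B"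
  shows "rob (tensor_ring C A B) = rob A \<otimes> rob B"
    "rmul (tensor_ring C A B) \<in> Arr C"
    "Dom C (rmul (tensor_ring C A B)) = (rob A \<otimes> rob B) \<otimes> (rob A \<otimes> rob B)"
    "Cod C (rmul (tensor_ring C A B)) = rob A \<otimes> rob B"
    "rone (tensor_ring C A B) \<in> Arr C"
    "Dom C (rone (tensor_ring C A B)) = \<one>"
    "Cod C (rone (tensor_ring C A B)) = rob A \<otimes> rob B"
  using assms by (simp_all add: tensor_ring_def)

text \<open>The morphism \<open>a \<otimes> a' \<mapsto> f(a) g(a')\<close> is multiplicative because \<open>B\<close> is commutative: this is the
  coproduct property of the tensor product.\<close>

lemma ring_morphism_copair:
  assumes A: "ring C A" and A': "ring C A'" and B: "ring C B"
    and f: "ring_morphism C A B f" and g: "ring_morphism C A' B g"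
  shows "ring_morphism C (tensor_ring C A A') B (rmul B \<cdot> (f \<boxtimes> g))"
proof -
  let ?m = "rmul B"
  note t = A A' B ring_morphism_typing[OF f] ring_morphism_typing[OF g]
  have "(?m \<cdot> (f \<boxtimes> g)) \<cdot> rmul (tensor_ring C A A') =
      ?m \<cdot> (((f \<cdot> rmul A) \<boxtimes> (g \<cdot> rmul A')) \<cdot> middle_swap C (rob A) (rob A') (rob A) (rob A'))"
    using t by (simp add: tensor_ring_def)
  also have "\<dots> = ?m \<cdot> (((?m \<cdot> (f \<boxtimes> f)) \<boxtimes> (?m \<cdot> (g \<boxtimes> g))) \<cdot> middle_swap C (rob A) (rob A') (rob A) (rob A'))"
    by (simp only: ring_morphism_laws(1)[OF f] ring_morphism_laws(1)[OF g])
  also have "\<dots> = ?m \<cdot> ((?m \<cdot> (f \<boxtimes> g)) \<boxtimes> (?m \<cdot> (f \<boxtimes> g)))"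
    using mult_middle_swap[OF B, of f "rob A" g "rob A'" f "rob A" g "rob A'"] t by simp
  finally have mul: "(?m \<cdot> (f \<boxtimes> g)) \<cdot> rmul (tensor_ring C A A') =
      ?m \<cdot> ((?m \<cdot> (f \<boxtimes> g)) \<boxtimes> (?m \<cdot> (f \<boxtimes> g)))" .
  have "(?m \<cdot> (f \<boxtimes> g)) \<cdot> rone (tensor_ring C A A')
      = (?m \<cdot> ((f \<cdot> rone A) \<boxtimes> (g \<cdot> rone A'))) \<cdot> inverse_arr C (LUnit C \<one>)"
    using t by (simp add: tensor_ring_def)
  also have "\<dots> = (?m \<cdot> (rone B \<boxtimes> rone B)) \<cdot> inverse_arr C (LUnit C \<one>)"
    by (simp only: ring_morphism_laws(2)[OF f] ring_morphism_laws(2)[OF g])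
  also have "\<dots> = rone B"
    using mult_one(1)[OF B, of "rone B" \<one>] t by simp
  finally show ?thesis
    using mul t by (simp add: ring_morphism_def)
qed

lemma ring_morphism_inverse:
  assumes h: "ring_morphism C (tensor_ring C A A') P h" "iso_arr C h" and A: "ring C A" "ring C A'" and P: "ring C P"
  shows "ring_morphism C P (tensor_ring C A A') (inverse_arr C h)"
proof -
  let ?T = "tensor_ring C A A'" and ?g = "inverse_arr C h"
  note t = A P h(2) ring_morphism_typing[OF h(1)]
  have "h \<cdot> (?g \<cdot> rmul P) = (rmul P \<cdot> (h \<boxtimes> h)) \<cdot> (?g \<boxtimes> ?g)"
    using t by simp
  also have "\<dots> = (h \<cdot> rmul ?T) \<cdot> (?g \<boxtimes> ?g)"
    by (simp only: ring_morphism_laws(1)[OF h(1)])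
  also have "\<dots> = h \<cdot> (rmul ?T \<cdot> (?g \<boxtimes> ?g))"
    using t by simp
  finally have e: "h \<cdot> (?g \<cdot> rmul P) = h \<cdot> (rmul ?T \<cdot> (?g \<boxtimes> ?g))" .
  have "?g \<cdot> rmul P = rmul ?T \<cdot> (?g \<boxtimes> ?g)"
    by (rule iso_mono[OF h(2) _ _ _ _ e]) (use t in simp_all)
  moreover have "?g \<cdot> rone P = rone ?T"
    using t inverse_arr_cancel(1)[OF h(2), of "rone ?T"] ring_morphism_laws(2)[OF h(1)] by simp
  ultimately show ?thesis
    using t by (simp add: ring_morphism_def)
qed

text \<open>The projector onto the second factor is multiplication by the idempotent \<open>(0, 1)\<close>, which shows as
  linearity over the product ring.  It is checked on both components.\<close>

lemma product_idempotent_linear: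
  assumes P: "product_ring C P A A' p1 p2" and A: "ring C A" "ring C A'"
    and bi: "biproduct C (rob P) (rob A) (rob A') i1 i2 p1 p2"
  shows "(i2 \<cdot> p2) \<cdot> rmul P = rmul P \<cdot> (Id C (rob P) \<boxtimes> (i2 \<cdot> p2))"
proof -
  let ?e = "i2 \<cdot> p2"
  have rP: "ring C P" and m1: "ring_morphism C P A p1" and m2: "ring_morphism C P A' p2"
    using P by (simp_all add: product_ring_def)
  have t: "i1 \<in> hom C (rob A) (rob P)" "i2 \<in> hom C (rob A') (rob P)" "p1 \<in> hom C (rob P) (rob A)"
      "p2 \<in> hom C (rob P) (rob A')" and pi: "p2 \<cdot> i2 = Id C (rob A')" "p1 \<cdot> i2 = Zero C (rob A') (rob A)"
    using bi by (simp_all only: biproduct_def)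
  note t = t rP A
  have p1e: "p1 \<cdot> ?e = Zero C (rob P) (rob A)"
    using comp_rewrite[OF pi(2), of p2] t by simp
  have p2e: "p2 \<cdot> ?e = p2"
    using comp_rewrite[OF pi(1), of p2] t by simp
  show ?thesis
  proof (rule biproduct_joint_mono[OF bi])
    have "p1 \<cdot> (?e \<cdot> rmul P) = (p1 \<cdot> ?e) \<cdot> rmul P" using t by simp
    also have "\<dots> = Zero C (rob P \<otimes> rob P) (rob A)" using t by (simp only: p1e) simp
    finally have l: "p1 \<cdot> (?e \<cdot> rmul P) = Zero C (rob P \<otimes> rob P) (rob A)" .
    have "p1 \<cdot> (rmul P \<cdot> (Id C (rob P) \<boxtimes> ?e)) = (p1 \<cdot> rmul P) \<cdot> (Id C (rob P) \<boxtimes> ?e)" using t by simp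
    also have "\<dots> = (rmul A \<cdot> (p1 \<boxtimes> p1)) \<cdot> (Id C (rob P) \<boxtimes> ?e)"
      by (simp only: ring_morphism_laws(1)[OF m1])
    also have "\<dots> = rmul A \<cdot> (p1 \<boxtimes> (p1 \<cdot> ?e))" using t by simp
    also have "\<dots> = Zero C (rob P \<otimes> rob P) (rob A)"
      using t by (simp only: p1e) (simp add: tens_zero_right)
    finally show "p1 \<cdot> (?e \<cdot> rmul P) = p1 \<cdot> (rmul P \<cdot> (Id C (rob P) \<boxtimes> ?e))" using l by simp
    have "p2 \<cdot> (?e \<cdot> rmul P) = (p2 \<cdot> ?e) \<cdot> rmul P" using t by simp
    also have "\<dots> = rmul A' \<cdot> (p2 \<boxtimes> (p2 \<cdot> ?e))" by (simp only: p2e ring_morphism_laws(1)[OF m2])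
    also have "\<dots> = (rmul A' \<cdot> (p2 \<boxtimes> p2)) \<cdot> (Id C (rob P) \<boxtimes> ?e)" using t by simp
    also have "\<dots> = (p2 \<cdot> rmul P) \<cdot> (Id C (rob P) \<boxtimes> ?e)" by (simp only: ring_morphism_laws(1)[OF m2])
    also have "\<dots> = p2 \<cdot> (rmul P \<cdot> (Id C (rob P) \<boxtimes> ?e))" using t by simp
    finally show "p2 \<cdot> (?e \<cdot> rmul P) = p2 \<cdot> (rmul P \<cdot> (Id C (rob P) \<boxtimes> ?e))" .
  qed (use t in simp_all)
qed

end

text \<open>The condition on idempotents in the definition of an indecomposable ring, separated because it is
  the part that is carried over from an algebra to the corresponding ring in a module category.\<close>

definition trivial_idempotents :: "('o, 'm, 'x) moncat_scheme \<Rightarrow> ('o, 'm) ring_data \<Rightarrow> bool" where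
  "trivial_idempotents C B \<longleftrightarrow>
     (\<forall>e. linear_arr C B (regular_module B) (regular_module B) e \<and> e \<cdot>\<^bsub>C\<^esub> e = e \<longrightarrow>
        e = Id C (rob B) \<or> e = Zero C (rob B) (rob B))"

context symmetric_monoidal_category
begin

text \<open>The endomorphism \<open>b \<mapsto> b\<epsilon>\<close> commutes with multiplications by associativity.\<close>

lemma mult_by_element_linear:
  assumes B: "ring C B" and t: "\<epsilon> \<in> hom C \<one> (rob B)"
    and e: "e \<in> hom C (rob B) (rob B)" "e \<cdot> RUnit C (rob B) = rmul B \<cdot> (Id C (rob B) \<boxtimes> \<epsilon>)"
  shows "e \<cdot> rmul B = rmul B \<cdot> (Id C (rob B) \<boxtimes> e)"
proof -
  let ?b = "rob B" and ?m = "rmul B" and ?I = "Id C (rob B)" and ?r = "RUnit C (rob B)"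
  let ?a = "Assoc C ?b ?b \<one>"
  note t = B t e(1)
  have "(e \<cdot> ?m) \<cdot> ((?I \<boxtimes> ?r) \<cdot> ?a) = (e \<cdot> ?r) \<cdot> (?m \<boxtimes> Id C \<one>)"
    using t runit_nat[of ?m ?b] by (simp add: runit_tens)
  also have "\<dots> = (?m \<cdot> (?I \<boxtimes> \<epsilon>)) \<cdot> (?m \<boxtimes> Id C \<one>)" by (simp only: e(2))
  also have "\<dots> = ?m \<cdot> ((?m \<cdot> (?I \<boxtimes> ?I)) \<boxtimes> \<epsilon>)" using t by simp
  also have "\<dots> = ?m \<cdot> ((?I \<boxtimes> (?m \<cdot> (?I \<boxtimes> \<epsilon>))) \<cdot> ?a)"
    using t by (intro mult_assoc) simp_all
  also have "\<dots> = ?m \<cdot> ((?I \<boxtimes> (e \<cdot> ?r)) \<cdot> ?a)" by (simp only: e(2))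
  also have "\<dots> = (?m \<cdot> (?I \<boxtimes> e)) \<cdot> ((?I \<boxtimes> ?r) \<cdot> ?a)" using t by simp
  finally have eq: "(e \<cdot> ?m) \<cdot> ((?I \<boxtimes> ?r) \<cdot> ?a) = (?m \<cdot> (?I \<boxtimes> e)) \<cdot> ((?I \<boxtimes> ?r) \<cdot> ?a)" .
  have iso: "iso_arr C ((?I \<boxtimes> ?r) \<cdot> ?a)" using t by (simp add: runit_tens)
  show ?thesis by (rule iso_epi[OF iso _ _ _ _ eq]) (use t in simp_all)
qed

text \<open>The image \<open>\<epsilon>\<close> of the idempotent \<open>(0, 1)\<close> is an idempotent element of \<open>B\<close>, so that multiplication by
  \<open>\<epsilon>\<close> is the identity or zero.  Composing \<open>k\<close> with the projector onto the second factor amounts to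
  multiplying \<open>k\<close> by \<open>\<epsilon>\<close>; in the first case \<open>k\<close> factors through \<open>A'\<close>, in the second through \<open>A\<close>.\<close>

lemma ring_morphism_from_product:
  assumes P: "product_ring C P A A' p1 p2" and A: "ring C A" "ring C A'"
    and bi: "biproduct C (rob P) (rob A) (rob A') i1 i2 p1 p2"
    and B: "ring C B" "trivial_idempotents C B" and k: "ring_morphism C P B k"
  shows "k \<cdot> (i1 \<cdot> p1) = k \<or> k \<cdot> (i2 \<cdot> p2) = k"
proof -
  have rP: "ring C P" using P by (simp add: product_ring_def)
  have t: "i1 \<in> hom C (rob A) (rob P)" "i2 \<in> hom C (rob A') (rob P)" "p1 \<in> hom C (rob P) (rob A)"
      "p2 \<in> hom C (rob P) (rob A')" and pi: "p2 \<cdot> i2 = Id C (rob A')"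
      and sum: "(i1 \<cdot> p1) \<oplus> (i2 \<cdot> p2) = Id C (rob P)"
    using bi by (simp_all only: biproduct_def)
  let ?e = "i2 \<cdot> p2" and ?m = "rmul B" and ?r = "RUnit C (rob B)"
  let ?\<epsilon> = "k \<cdot> (?e \<cdot> rone P)"
  let ?f = "?m \<cdot> ((Id C (rob B) \<boxtimes> ?\<epsilon>) \<cdot> inverse_arr C ?r)"
  note t = t rP A B(1) ring_morphism_typing[OF k]
  have fr: "?f \<cdot> ?r = ?m \<cdot> (Id C (rob B) \<boxtimes> ?\<epsilon>)" using t by simp
  have ft: "?f \<in> hom C (rob B) (rob B)" using t by simp
  have fm: "?f \<cdot> ?m = ?m \<cdot> (Id C (rob B) \<boxtimes> ?f)"
    by (rule mult_by_element_linear[OF B(1) _ ft fr]) (use t in simp)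
  have ee: "?e \<cdot> ?e = ?e" using t comp_rewrite[OF pi, of p2] by simp
  have "(k \<cdot> ?e) \<cdot> RUnit C (rob P) = k \<cdot> (?e \<cdot> (rmul P \<cdot> (Id C (rob P) \<boxtimes> rone P)))"
    using t by (simp only: ring_laws(4)[OF rP]) simp
  also have "\<dots> = k \<cdot> ((?e \<cdot> rmul P) \<cdot> (Id C (rob P) \<boxtimes> rone P))" using t by simp
  also have "\<dots> = k \<cdot> ((rmul P \<cdot> (Id C (rob P) \<boxtimes> ?e)) \<cdot> (Id C (rob P) \<boxtimes> rone P))"
    by (simp only: product_idempotent_linear[OF P A bi])
  also have "\<dots> = (k \<cdot> rmul P) \<cdot> (Id C (rob P) \<boxtimes> (?e \<cdot> rone P))" using t by simp
  also have "\<dots> = (?m \<cdot> (k \<boxtimes> k)) \<cdot> (Id C (rob P) \<boxtimes> (?e \<cdot> rone P))"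
    by (simp only: ring_morphism_laws(1)[OF k])
  also have "\<dots> = (?m \<cdot> (Id C (rob B) \<boxtimes> ?\<epsilon>)) \<cdot> (k \<boxtimes> Id C \<one>)" using t by simp
  also have "\<dots> = (?f \<cdot> ?r) \<cdot> (k \<boxtimes> Id C \<one>)" by (simp only: fr)
  also have "\<dots> = ?f \<cdot> (?r \<cdot> (k \<boxtimes> Id C \<one>))" using t ft by (intro comp_assoc') simp_all
  also have "\<dots> = ?f \<cdot> (k \<cdot> RUnit C (rob P))" using t runit_nat[of k "rob B"] by simp
  also have "\<dots> = (?f \<cdot> k) \<cdot> RUnit C (rob P)" using t ft by simp
  finally have eq: "(k \<cdot> ?e) \<cdot> RUnit C (rob P) = (?f \<cdot> k) \<cdot> RUnit C (rob P)" .
  have ke: "k \<cdot> ?e = ?f \<cdot> k"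
    by (rule iso_epi[OF _ _ _ _ _ eq]) (use t ft in simp_all)
  have kee: "(k \<cdot> ?e) \<cdot> ?e = k \<cdot> ?e"
    using t ee by (metis comp_assoc' comp_typing hom_iff)
  have "?f \<cdot> ?\<epsilon> = (?f \<cdot> k) \<cdot> (?e \<cdot> rone P)" using t ft by (intro comp_assoc'[symmetric]) simp_all
  also have "\<dots> = (k \<cdot> ?e) \<cdot> (?e \<cdot> rone P)" by (simp only: ke)
  also have "\<dots> = k \<cdot> ((?e \<cdot> ?e) \<cdot> rone P)" using t by simp
  also have "\<dots> = ?\<epsilon>" by (simp only: ee)
  finally have f\<epsilon>: "?f \<cdot> ?\<epsilon> = ?\<epsilon>" .
  have "(?f \<cdot> ?f) \<cdot> ?r = ?f \<cdot> (?f \<cdot> ?r)" using ft t by (intro comp_assoc') simp_all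
  also have "\<dots> = ?f \<cdot> (?m \<cdot> (Id C (rob B) \<boxtimes> ?\<epsilon>))" by (simp only: fr)
  also have "\<dots> = (?f \<cdot> ?m) \<cdot> (Id C (rob B) \<boxtimes> ?\<epsilon>)" using ft t by (intro comp_assoc'[symmetric]) simp_all
  also have "\<dots> = (?m \<cdot> (Id C (rob B) \<boxtimes> ?f)) \<cdot> (Id C (rob B) \<boxtimes> ?\<epsilon>)" by (simp only: fm)
  also have "\<dots> = ?m \<cdot> ((Id C (rob B) \<boxtimes> ?f) \<cdot> (Id C (rob B) \<boxtimes> ?\<epsilon>))" using ft t by (intro comp_assoc') simp_all
  also have "\<dots> = ?m \<cdot> ((Id C (rob B) \<cdot> Id C (rob B)) \<boxtimes> (?f \<cdot> ?\<epsilon>))" using ft t by (subst tens_comp') simp_all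
  also have "\<dots> = ?f \<cdot> ?r" using t by (simp only: f\<epsilon> fr) simp
  finally have ff: "(?f \<cdot> ?f) \<cdot> ?r = ?f \<cdot> ?r" .
  have "?f \<cdot> ?f = ?f"
    by (rule iso_epi[OF _ _ _ _ _ ff]) (use t in simp_all)
  moreover have "linear_arr C B (regular_module B) (regular_module B) ?f"
    using ft fm by (simp add: linear_arr_def regular_module_def)
  ultimately have "?f = Id C (rob B) \<or> ?f = Zero C (rob B) (rob B)"
    using B(2) unfolding trivial_idempotents_def by blast
  then show ?thesis
  proof
    assume "?f = Id C (rob B)"
    then have "k \<cdot> ?e = k" using ke t by simp
    then show ?thesis ..
  next
    assume "?f = Zero C (rob B) (rob B)"
    then have z: "k \<cdot> ?e = Zero C (rob P) (rob B)" using ke t by simp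
    have "k = k \<cdot> ((i1 \<cdot> p1) \<oplus> ?e)" using t by (simp only: sum) simp
    also have "\<dots> = (k \<cdot> (i1 \<cdot> p1)) \<oplus> (k \<cdot> ?e)"
      by (rule comp_add_right[of _ "rob P" "rob P" _ _ "rob B"]) (use t in simp_all)
    also have "\<dots> = k \<cdot> (i1 \<cdot> p1)"
      unfolding z by (rule add_zero) (use t in simp)
    finally show ?thesis by simp
  qed
qed

text \<open>A morphism factors through a split quotient ring as soon as it absorbs the corresponding projector.
  The factor is multiplicative because the tensor square of a split epimorphism is again one.\<close>

lemma ring_morphism_factor_split_epi:
  assumes A: "ring C A" and D: "ring C D" and B: "ring C B"
    and p: "ring_morphism C A D p" and i: "i \<in> hom C (rob D) (rob A)" "p \<cdot> i = Id C (rob D)"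
    and k: "ring_morphism C A B k" "k \<cdot> (i \<cdot> p) = k"
  shows "ring_morphism C D B (k \<cdot> i)"
proof -
  note t = A D B i(1) ring_morphism_typing[OF p] ring_morphism_typing[OF k(1)]
  have ki: "(k \<cdot> i) \<cdot> p = k" using t k(2) by simp
  have "(k \<cdot> i) \<cdot> rmul D = ((k \<cdot> i) \<cdot> rmul D) \<cdot> ((p \<cdot> i) \<boxtimes> (p \<cdot> i))"
    using t by (simp only: i(2)) simp
  also have "\<dots> = (k \<cdot> i) \<cdot> ((rmul D \<cdot> (p \<boxtimes> p)) \<cdot> (i \<boxtimes> i))" using t by simp
  also have "\<dots> = (k \<cdot> i) \<cdot> ((p \<cdot> rmul A) \<cdot> (i \<boxtimes> i))" by (simp only: ring_morphism_laws(1)[OF p])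
  also have "\<dots> = (((k \<cdot> i) \<cdot> p) \<cdot> rmul A) \<cdot> (i \<boxtimes> i)" using t by simp
  also have "\<dots> = (rmul B \<cdot> (k \<boxtimes> k)) \<cdot> (i \<boxtimes> i)" by (simp only: ki ring_morphism_laws(1)[OF k(1)])
  also have "\<dots> = rmul B \<cdot> ((k \<cdot> i) \<boxtimes> (k \<cdot> i))" using t by simp
  finally have mul: "(k \<cdot> i) \<cdot> rmul D = rmul B \<cdot> ((k \<cdot> i) \<boxtimes> (k \<cdot> i))" .
  have "(k \<cdot> i) \<cdot> rone D = (k \<cdot> i) \<cdot> (p \<cdot> rone A)" by (simp only: ring_morphism_laws(2)[OF p])
  also have "\<dots> = ((k \<cdot> i) \<cdot> p) \<cdot> rone A" using t by simp
  also have "\<dots> = rone B" by (simp only: ki ring_morphism_laws(2)[OF k(1)])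
  finally show ?thesis using mul t by (simp add: ring_morphism_def)
qed

text \<open>Under \<open>A \<otimes> A \<cong> A \<times> A'\<close> the morphism \<open>a \<otimes> a' \<mapsto> k0(a) k1(a')\<close> factors through one of the factors.  Its restrictions
  along \<open>a \<mapsto> a \<otimes> 1\<close> and \<open>a \<mapsto> 1 \<otimes> a\<close> are \<open>k0\<close> and \<open>k1\<close>.  Both of these maps are sections of the
  multiplication, so a factorisation through \<open>A\<close> contradicts \<open>k0 \<noteq> k1\<close>.  The arrow \<open>w\<close> is
  \<open>a \<mapsto> 1 \<otimes> a\<close> followed by the projection to \<open>A'\<close>; it is obtained before \<open>B\<close>, \<open>k0\<close> and \<open>k1\<close> because
  counting requires one \<open>w\<close> for all \<open>k1\<close>.\<close>

lemma splitting_algebra_extension: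
  assumes A: "ring C A" and spl: "splitting_algebra C A A' \<phi>"
  obtains w where "\<And>B k0 k1. \<lbrakk>ring C B; trivial_idempotents C B; ring_morphism C A B k0; ring_morphism C A B k1;
       k0 \<noteq> k1\<rbrakk> \<Longrightarrow> \<exists>\<psi>. ring_morphism C A' B \<psi> \<and> \<psi> \<cdot> \<phi> = k0 \<and> \<psi> \<cdot> w = k1"
proof -
  have A': "ring C A'" using spl by (simp add: splitting_algebra_def separable_ring_def)
  obtain P p1 p2 h where P: "product_ring C P A A' p1 p2"
    and h: "ring_morphism C (tensor_ring C A A) P h" "iso_arr C h"
    and p1h: "p1 \<cdot> h = rmul A"
    and \<phi>: "p2 \<cdot> h \<cdot> (Id C (rob A) \<boxtimes> rone A) \<cdot> inverse_arr C (RUnit C (rob A)) = \<phi>"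
    using spl unfolding splitting_algebra_def by blast
  obtain i1 i2 where bi: "biproduct C (rob P) (rob A) (rob A') i1 i2 p1 p2"
    and p2: "ring_morphism C P A' p2" and rP: "ring C P"
    using P unfolding product_ring_def by blast
  have bt: "i1 \<in> hom C (rob A) (rob P)" "i2 \<in> hom C (rob A') (rob P)" "p1 \<in> hom C (rob P) (rob A)"
      "p2 \<in> hom C (rob P) (rob A')" and pi: "p2 \<cdot> i2 = Id C (rob A')"
    using bi by (simp_all only: biproduct_def)
  let ?R = "(Id C (rob A) \<boxtimes> rone A) \<cdot> inverse_arr C (RUnit C (rob A))"
  let ?L = "(rone A \<boxtimes> Id C (rob A)) \<cdot> inverse_arr C (LUnit C (rob A))"
  define w where "w = p2 \<cdot> (h \<cdot> ?L)"
  note t = A A' rP bt ring_morphism_typing[OF h(1)]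
  have mR: "rmul A \<cdot> ?R = Id C (rob A)" and mL: "rmul A \<cdot> ?L = Id C (rob A)"
    using t comp_rewrite[OF ring_laws(4)[OF A], of "inverse_arr C (RUnit C (rob A))"]
      comp_rewrite[OF ring_laws(3)[OF A], of "inverse_arr C (LUnit C (rob A))"] by simp_all
  show ?thesis
  proof (rule that[of w])
    fix B k0 k1
    assume B: "ring C B" "trivial_idempotents C B" and k0: "ring_morphism C A B k0"
      and k1: "ring_morphism C A B k1" and ne: "k0 \<noteq> k1"
    let ?\<Phi> = "rmul B \<cdot> (k0 \<boxtimes> k1)"
    let ?k = "?\<Phi> \<cdot> inverse_arr C h"
    note t = t B(1) h(2) ring_morphism_typing[OF k0] ring_morphism_typing[OF k1]
    have \<Phi>: "ring_morphism C (tensor_ring C A A) B ?\<Phi>"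
      by (rule ring_morphism_copair[OF A A B(1) k0 k1])
    have kt: "?k \<in> hom C (rob P) (rob B)" using t by simp
    have kh: "?k \<cdot> h = ?\<Phi>" using t by simp
    have "?\<Phi> \<cdot> ?R = (rmul B \<cdot> (k0 \<boxtimes> (k1 \<cdot> rone A))) \<cdot> inverse_arr C (RUnit C (rob A))" using t by simp
    also have "\<dots> = (rmul B \<cdot> (k0 \<boxtimes> rone B)) \<cdot> inverse_arr C (RUnit C (rob A))"
      by (simp only: ring_morphism_laws(2)[OF k1])
    also have "\<dots> = k0" using t mult_one(2)[OF B(1), of k0 "rob A"] by simp
    finally have \<Phi>R: "?\<Phi> \<cdot> ?R = k0" .
    have "?\<Phi> \<cdot> ?L = (rmul B \<cdot> ((k0 \<cdot> rone A) \<boxtimes> k1)) \<cdot> inverse_arr C (LUnit C (rob A))" using t by simp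
    also have "\<dots> = (rmul B \<cdot> (rone B \<boxtimes> k1)) \<cdot> inverse_arr C (LUnit C (rob A))"
      by (simp only: ring_morphism_laws(2)[OF k0])
    also have "\<dots> = k1" using t mult_one(1)[OF B(1), of k1 "rob A"] by simp
    finally have \<Phi>L: "?\<Phi> \<cdot> ?L = k1" .
    have k: "ring_morphism C P B ?k"
    proof -
      let ?T = "tensor_ring C A A" and ?g = "inverse_arr C h"
      have g: "ring_morphism C P ?T ?g" by (rule ring_morphism_inverse[OF h A A rP])
      have "?k \<cdot> rmul P = ?\<Phi> \<cdot> (?g \<cdot> rmul P)" using t by simp
      also have "\<dots> = ?\<Phi> \<cdot> (rmul ?T \<cdot> (?g \<boxtimes> ?g))" by (simp only: ring_morphism_laws(1)[OF g])
      also have "\<dots> = (?\<Phi> \<cdot> rmul ?T) \<cdot> (?g \<boxtimes> ?g)" using t by simp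
      also have "\<dots> = (rmul B \<cdot> (?\<Phi> \<boxtimes> ?\<Phi>)) \<cdot> (?g \<boxtimes> ?g)" by (simp only: ring_morphism_laws(1)[OF \<Phi>])
      also have "\<dots> = rmul B \<cdot> (?k \<boxtimes> ?k)" using t by simp
      finally have mul: "?k \<cdot> rmul P = rmul B \<cdot> (?k \<boxtimes> ?k)" .
      have "?k \<cdot> rone P = ?\<Phi> \<cdot> (?g \<cdot> rone P)" using t by simp
      also have "\<dots> = rone B" by (simp only: ring_morphism_laws(2)[OF g] ring_morphism_laws(2)[OF \<Phi>])
      finally show ?thesis using mul kt unfolding ring_morphism_def by blast
    qed
    from ring_morphism_from_product[OF P A A' bi B k]
    show "\<exists>\<psi>. ring_morphism C A' B \<psi> \<and> \<psi> \<cdot> \<phi> = k0 \<and> \<psi> \<cdot> w = k1"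
    proof
      assume e: "?k \<cdot> (i1 \<cdot> p1) = ?k"
      have *: "?\<Phi> \<cdot> X = ?k \<cdot> i1" if X: "X \<in> hom C (rob A) (rob A \<otimes> rob A)" "rmul A \<cdot> X = Id C (rob A)" for X
      proof -
        have "?\<Phi> \<cdot> X = (?k \<cdot> (i1 \<cdot> p1)) \<cdot> (h \<cdot> X)" unfolding e using t X(1) by simp
        also have "\<dots> = (?k \<cdot> i1) \<cdot> ((p1 \<cdot> h) \<cdot> X)" using t X(1) by simp
        also have "\<dots> = (?k \<cdot> i1) \<cdot> (rmul A \<cdot> X)" by (simp only: p1h)
        also have "\<dots> = ?k \<cdot> i1" unfolding X(2) using t by simp
        finally show ?thesis .
      qed
      have "?\<Phi> \<cdot> ?R = ?k \<cdot> i1" by (rule *[OF _ mR]) (use t in simp)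
      moreover have "?\<Phi> \<cdot> ?L = ?k \<cdot> i1" by (rule *[OF _ mL]) (use t in simp)
      ultimately have False using \<Phi>R \<Phi>L ne by argo
      then show ?thesis ..
    next
      assume e: "?k \<cdot> (i2 \<cdot> p2) = ?k"
      have \<psi>: "ring_morphism C A' B (?k \<cdot> i2)"
        by (rule ring_morphism_factor_split_epi[OF rP A' B(1) p2 bt(2) pi k e])
      have *: "(?k \<cdot> i2) \<cdot> (p2 \<cdot> (h \<cdot> X)) = ?\<Phi> \<cdot> X" if X: "X \<in> hom C (rob A) (rob A \<otimes> rob A)" for X
      proof -
        have "(?k \<cdot> i2) \<cdot> (p2 \<cdot> (h \<cdot> X)) = (?k \<cdot> (i2 \<cdot> p2)) \<cdot> (h \<cdot> X)" using t X by simp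
        also have "\<dots> = ?\<Phi> \<cdot> X" unfolding e using t X by simp
        finally show ?thesis .
      qed
      have "(?k \<cdot> i2) \<cdot> \<phi> = k0"
        unfolding \<phi>[symmetric] by (rule trans[OF * \<Phi>R]) (use t in simp)
      moreover have "(?k \<cdot> i2) \<cdot> w = k1"
        unfolding w_def by (rule trans[OF * \<Phi>L]) (use t in simp)
      ultimately show ?thesis using \<psi> by blast
    qed
  qed
qed

end

context symmetric_monoidal_category
begin

section \<open>Separability splits relative tensor products\<close>

lemma pentagon_inv:
  assumes "w \<in> Ob C" "x \<in> Ob C" "y \<in> Ob C" "z \<in> Ob C"
  shows "inverse_arr C (Assoc C w x (y \<otimes> z)) \<cdot> (Id C w \<boxtimes> Assoc C x y z) =
      Assoc C (w \<otimes> x) y z \<cdot> ((inverse_arr C (Assoc C w x y) \<boxtimes> Id C z) \<cdot> inverse_arr C (Assoc C w (x \<otimes> y) z))"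
    and "(inverse_arr C (Assoc C w x y) \<boxtimes> Id C z) \<cdot>
        (inverse_arr C (Assoc C w (x \<otimes> y) z) \<cdot> (Id C w \<boxtimes> inverse_arr C (Assoc C x y z))) =
      inverse_arr C (Assoc C (w \<otimes> x) y z) \<cdot> inverse_arr C (Assoc C w x (y \<otimes> z))"
proof -
  let ?a1 = "Assoc C w x (y \<otimes> z)" and ?a2 = "Assoc C (w \<otimes> x) y z" and ?a3 = "Assoc C w (x \<otimes> y) z"
  let ?a4 = "Assoc C w x y" and ?a5 = "Assoc C x y z"
  let ?i = "inverse_arr C"
  let ?Z = "(?i ?a4 \<boxtimes> Id C z) \<cdot> ?i ?a3"
  have "?a1 \<cdot> (?a2 \<cdot> ?Z) = (?a1 \<cdot> ?a2) \<cdot> ?Z" using assms by simp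
  also have "\<dots> = ((Id C w \<boxtimes> ?a5) \<cdot> ?a3 \<cdot> (?a4 \<boxtimes> Id C z)) \<cdot> ?Z"
    by (simp only: pentagon[OF assms])
  also have "\<dots> = Id C w \<boxtimes> ?a5" using assms by simp
  finally have 1: "?a1 \<cdot> (?a2 \<cdot> ?Z) = Id C w \<boxtimes> ?a5" .
  show 2: "?i ?a1 \<cdot> (Id C w \<boxtimes> ?a5) = ?a2 \<cdot> ?Z"
    using assms by (simp only: 1[symmetric]) simp
  have "?Z \<cdot> (Id C w \<boxtimes> ?i ?a5) = ?i ?a2 \<cdot> ((?a2 \<cdot> ?Z) \<cdot> (Id C w \<boxtimes> ?i ?a5))" using assms by simp
  also have "\<dots> = ?i ?a2 \<cdot> ((?i ?a1 \<cdot> (Id C w \<boxtimes> ?a5)) \<cdot> (Id C w \<boxtimes> ?i ?a5))" by (simp only: 2)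
  also have "\<dots> = ?i ?a2 \<cdot> ?i ?a1" using assms by simp
  finally show "(?i ?a4 \<boxtimes> Id C z) \<cdot> (?i ?a3 \<cdot> (Id C w \<boxtimes> ?i ?a5)) = ?i ?a2 \<cdot> ?i ?a1"
    using assms by simp
qed

text \<open>A right module over a separable ring is relatively projective: its action has the linear section
  \<open>x \<mapsto> x \<sigma>\<^sub>1 \<otimes> \<sigma>\<^sub>2\<close>, where \<open>\<sigma>(1) = \<sigma>\<^sub>1 \<otimes> \<sigma>\<^sub>2\<close> is the separability element.  The stated identity says
  that \<open>\<tau>\<close> is linear.\<close>

lemma separable_section:
  assumes sep: "separable_ring C R" and x: "x \<in> Ob C"
    and \<rho>: "\<rho> \<in> hom C (x \<otimes> rob R) x"
    and \<rho>_assoc: "\<rho> \<cdot> (\<rho> \<boxtimes> Id C (rob R)) = \<rho> \<cdot> ((Id C x \<boxtimes> rmul R) \<cdot> Assoc C x (rob R) (rob R))"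
    and \<rho>_one: "\<rho> \<cdot> (Id C x \<boxtimes> rone R) = RUnit C x"
  obtains \<tau> where "\<tau> \<in> hom C x (x \<otimes> rob R)" "\<rho> \<cdot> \<tau> = Id C x"
    "\<tau> \<cdot> \<rho> = (Id C x \<boxtimes> rmul R) \<cdot> (Assoc C x (rob R) (rob R) \<cdot> (\<tau> \<boxtimes> Id C (rob R)))"
proof -
  let ?a = "rob R" and ?m = "rmul R" and ?A = "Id C (rob R)" and ?X = "Id C x"
  let ?i = "inverse_arr C"
  let ?as = "Assoc C x ?a ?a"
  have R: "ring C R" using sep by (simp add: separable_ring_def)
  obtain \<sigma> where \<sigma>: "\<sigma> \<in> hom C ?a (?a \<otimes> ?a)" and m\<sigma>: "?m \<cdot> \<sigma> = ?A"
    and \<sigma>r: "(?A \<boxtimes> ?m) \<cdot> Assoc C ?a ?a ?a \<cdot> (\<sigma> \<boxtimes> ?A) = \<sigma> \<cdot> ?m"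
    and \<sigma>l: "(?m \<boxtimes> ?A) \<cdot> ?i (Assoc C ?a ?a ?a) \<cdot> (?A \<boxtimes> \<sigma>) = \<sigma> \<cdot> ?m"
    using sep unfolding separable_ring_def Let_def by blast
  note t = R x \<rho> \<sigma>
  \<comment> \<open>In terms of elements, \<open>U (x \<otimes> r) = x \<sigma>(r)\<^sub>1 \<otimes> \<sigma>(r)\<^sub>2\<close> and \<open>\<tau> x = U (x \<otimes> 1)\<close>.\<close>
  define U where "U = (\<rho> \<boxtimes> ?A) \<cdot> (?i ?as \<cdot> (?X \<boxtimes> \<sigma>))"
  define \<tau> where "\<tau> = U \<cdot> ((?X \<boxtimes> rone R) \<cdot> ?i (RUnit C x))"
  have U: "U \<in> hom C (x \<otimes> ?a) (x \<otimes> ?a)" using t by (simp add: U_def)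
  have \<tau>: "\<tau> \<in> hom C x (x \<otimes> ?a)" using t U by (simp add: \<tau>_def)
  have \<tau>r: "\<tau> \<cdot> RUnit C x = U \<cdot> (?X \<boxtimes> rone R)" using t U by (simp add: \<tau>_def)
  have "\<rho> \<cdot> U = (\<rho> \<cdot> (\<rho> \<boxtimes> ?A)) \<cdot> (?i ?as \<cdot> (?X \<boxtimes> \<sigma>))" using t by (simp add: U_def)
  also have "\<dots> = (\<rho> \<cdot> ((?X \<boxtimes> ?m) \<cdot> ?as)) \<cdot> (?i ?as \<cdot> (?X \<boxtimes> \<sigma>))" by (simp only: \<rho>_assoc)
  also have "\<dots> = \<rho> \<cdot> (?X \<boxtimes> (?m \<cdot> \<sigma>))" using t by simp
  also have "\<dots> = \<rho>" unfolding m\<sigma> using t by simp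
  finally have \<rho>U: "\<rho> \<cdot> U = \<rho>" .
  have "\<rho> \<cdot> \<tau> = (\<rho> \<cdot> U) \<cdot> ((?X \<boxtimes> rone R) \<cdot> ?i (RUnit C x))" using t U by (simp add: \<tau>_def)
  also have "\<dots> = (\<rho> \<cdot> (?X \<boxtimes> rone R)) \<cdot> ?i (RUnit C x)" unfolding \<rho>U using t by simp
  also have "\<dots> = ?X" unfolding \<rho>_one using t by simp
  finally have \<rho>\<tau>: "\<rho> \<cdot> \<tau> = ?X" .
  \<comment> \<open>Since \<open>\<sigma>\<close> is right linear, \<open>U (x \<otimes> rr') = U (x \<otimes> r) r'\<close>; inserting \<open>r = 1\<close> expresses
    \<open>U (x \<otimes> r')\<close> as \<open>\<tau>(x) r'\<close>.\<close>
  have "U \<cdot> (?X \<boxtimes> ?m) = (\<rho> \<boxtimes> ?A) \<cdot> (?i ?as \<cdot> (?X \<boxtimes> (\<sigma> \<cdot> ?m)))" using t by (simp add: U_def)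
  also have "\<dots> = (\<rho> \<boxtimes> ?A) \<cdot> (?i ?as \<cdot> ((?X \<boxtimes> (?A \<boxtimes> ?m)) \<cdot> (?X \<boxtimes> (Assoc C ?a ?a ?a \<cdot> (\<sigma> \<boxtimes> ?A)))))"
    using t by (simp only: \<sigma>r[symmetric]) simp
  also have "\<dots> = (\<rho> \<boxtimes> ?A) \<cdot> (((?X \<boxtimes> ?A) \<boxtimes> ?m) \<cdot> (?i (Assoc C x ?a (?a \<otimes> ?a)) \<cdot> (?X \<boxtimes> (Assoc C ?a ?a ?a \<cdot> (\<sigma> \<boxtimes> ?A)))))"
    using assoc_inv_nat_chain[of ?X ?A ?m x ?a ?a "?X \<boxtimes> (Assoc C ?a ?a ?a \<cdot> (\<sigma> \<boxtimes> ?A))"] t by simp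
  also have "\<dots> = (\<rho> \<boxtimes> ?m) \<cdot> ((?i (Assoc C x ?a (?a \<otimes> ?a)) \<cdot> (?X \<boxtimes> Assoc C ?a ?a ?a)) \<cdot> (?X \<boxtimes> (\<sigma> \<boxtimes> ?A)))"
    using t by simp
  also have "\<dots> = (\<rho> \<boxtimes> ?m) \<cdot> ((Assoc C (x \<otimes> ?a) ?a ?a \<cdot> ((?i ?as \<boxtimes> ?A) \<cdot> ?i (Assoc C x (?a \<otimes> ?a) ?a))) \<cdot> (?X \<boxtimes> (\<sigma> \<boxtimes> ?A)))"
    using t by (subst pentagon_inv(1)) simp_all
  also have "\<dots> = (\<rho> \<boxtimes> ?m) \<cdot> (Assoc C (x \<otimes> ?a) ?a ?a \<cdot> ((?i ?as \<boxtimes> ?A) \<cdot> (((?X \<boxtimes> \<sigma>) \<boxtimes> ?A) \<cdot> ?i ?as)))"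
    using assoc_inv_nat[of ?X \<sigma> ?A x "?a \<otimes> ?a" ?a] t by simp
  also have "\<dots> = (?X \<boxtimes> ?m) \<cdot> ((\<rho> \<boxtimes> (?A \<boxtimes> ?A)) \<cdot> (Assoc C (x \<otimes> ?a) ?a ?a \<cdot> ((?i ?as \<cdot> (?X \<boxtimes> \<sigma>)) \<boxtimes> ?A \<cdot> ?i ?as)))"
    using t by simp
  also have "\<dots> = (?X \<boxtimes> ?m) \<cdot> (?as \<cdot> (((\<rho> \<boxtimes> ?A) \<boxtimes> ?A) \<cdot> ((?i ?as \<cdot> (?X \<boxtimes> \<sigma>)) \<boxtimes> ?A \<cdot> ?i ?as)))"
    using assoc_nat_chain[of \<rho> ?A ?A x ?a ?a "(?i ?as \<cdot> (?X \<boxtimes> \<sigma>)) \<boxtimes> ?A \<cdot> ?i ?as"] t by simp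
  also have "\<dots> = (?X \<boxtimes> ?m) \<cdot> (?as \<cdot> ((U \<boxtimes> ?A) \<cdot> ?i ?as))" using t by (simp add: U_def)
  finally have U2: "U \<cdot> (?X \<boxtimes> ?m) = (?X \<boxtimes> ?m) \<cdot> (?as \<cdot> ((U \<boxtimes> ?A) \<cdot> ?i ?as))" .
  have "U \<cdot> (RUnit C x \<boxtimes> ?A) = U \<cdot> ((?X \<boxtimes> LUnit C ?a) \<cdot> Assoc C x \<one> ?a)"
    using triangle[of x ?a] t by simp
  also have "\<dots> = U \<cdot> ((?X \<boxtimes> (?m \<cdot> (rone R \<boxtimes> ?A))) \<cdot> Assoc C x \<one> ?a)"
    by (simp only: ring_laws(3)[OF R])
  also have "\<dots> = (U \<cdot> (?X \<boxtimes> ?m)) \<cdot> ((?X \<boxtimes> (rone R \<boxtimes> ?A)) \<cdot> Assoc C x \<one> ?a)"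
    using t U by simp
  also have "\<dots> = ((?X \<boxtimes> ?m) \<cdot> (?as \<cdot> ((U \<boxtimes> ?A) \<cdot> ?i ?as))) \<cdot> (?as \<cdot> ((?X \<boxtimes> rone R) \<boxtimes> ?A))"
    unfolding U2 using assoc_nat[of ?X "rone R" ?A x ?a ?a] t U by simp
  also have "\<dots> = (?X \<boxtimes> ?m) \<cdot> (?as \<cdot> ((U \<cdot> (?X \<boxtimes> rone R)) \<boxtimes> ?A))" using t U by simp
  also have "\<dots> = ((?X \<boxtimes> ?m) \<cdot> (?as \<cdot> (\<tau> \<boxtimes> ?A))) \<cdot> (RUnit C x \<boxtimes> ?A)"
    unfolding \<tau>r[symmetric] using t \<tau> by simp
  finally have e4: "U \<cdot> (RUnit C x \<boxtimes> ?A) = ((?X \<boxtimes> ?m) \<cdot> (?as \<cdot> (\<tau> \<boxtimes> ?A))) \<cdot> (RUnit C x \<boxtimes> ?A)" .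
  have U4: "U = (?X \<boxtimes> ?m) \<cdot> (?as \<cdot> (\<tau> \<boxtimes> ?A))"
    by (rule iso_epi[OF _ _ _ _ _ e4]) (use t \<tau> U in \<open>simp_all add: iso_tens iso_id\<close>)
  \<comment> \<open>Since \<open>\<sigma>\<close> is left linear, \<open>U (x \<otimes> rr') = U (xr \<otimes> r')\<close>; inserting \<open>r' = 1\<close> expresses
    \<open>U (x \<otimes> r)\<close> as \<open>\<tau>(xr)\<close>.\<close>
  have "U \<cdot> (?X \<boxtimes> ?m) = (\<rho> \<boxtimes> ?A) \<cdot> (?i ?as \<cdot> (?X \<boxtimes> (\<sigma> \<cdot> ?m)))" using t by (simp add: U_def)
  also have "\<dots> = (\<rho> \<boxtimes> ?A) \<cdot> (?i ?as \<cdot> ((?X \<boxtimes> (?m \<boxtimes> ?A)) \<cdot> (?X \<boxtimes> (?i (Assoc C ?a ?a ?a) \<cdot> (?A \<boxtimes> \<sigma>)))))"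
    using t by (simp only: \<sigma>l[symmetric]) simp
  also have "\<dots> = (\<rho> \<boxtimes> ?A) \<cdot> (((?X \<boxtimes> ?m) \<boxtimes> ?A) \<cdot> (?i (Assoc C x (?a \<otimes> ?a) ?a) \<cdot> (?X \<boxtimes> (?i (Assoc C ?a ?a ?a) \<cdot> (?A \<boxtimes> \<sigma>)))))"
    using assoc_inv_nat_chain[of ?X ?m ?A x ?a ?a "?X \<boxtimes> (?i (Assoc C ?a ?a ?a) \<cdot> (?A \<boxtimes> \<sigma>))"] t by simp
  also have "\<dots> = ((\<rho> \<cdot> ((?X \<boxtimes> ?m) \<cdot> ?as) \<cdot> ?i ?as) \<boxtimes> ?A) \<cdot> (?i (Assoc C x (?a \<otimes> ?a) ?a) \<cdot> (?X \<boxtimes> (?i (Assoc C ?a ?a ?a) \<cdot> (?A \<boxtimes> \<sigma>))))"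
    using t by simp
  also have "\<dots> = ((\<rho> \<cdot> (\<rho> \<boxtimes> ?A) \<cdot> ?i ?as) \<boxtimes> ?A) \<cdot> (?i (Assoc C x (?a \<otimes> ?a) ?a) \<cdot> (?X \<boxtimes> (?i (Assoc C ?a ?a ?a) \<cdot> (?A \<boxtimes> \<sigma>))))"
    using t comp_rewrite[OF \<rho>_assoc, of "?i ?as"] by simp
  also have "\<dots> = (\<rho> \<boxtimes> ?A) \<cdot> (((\<rho> \<boxtimes> ?A) \<boxtimes> ?A) \<cdot> (((?i ?as \<boxtimes> ?A) \<cdot> (?i (Assoc C x (?a \<otimes> ?a) ?a) \<cdot> (?X \<boxtimes> ?i (Assoc C ?a ?a ?a)))) \<cdot> (?X \<boxtimes> (?A \<boxtimes> \<sigma>))))"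
    using t by simp
  also have "\<dots> = (\<rho> \<boxtimes> ?A) \<cdot> (((\<rho> \<boxtimes> ?A) \<boxtimes> ?A) \<cdot> (?i (Assoc C (x \<otimes> ?a) ?a ?a) \<cdot> (?i (Assoc C x ?a (?a \<otimes> ?a)) \<cdot> (?X \<boxtimes> (?A \<boxtimes> \<sigma>)))))"
    using t by (subst pentagon_inv(2)) simp_all
  also have "\<dots> = (\<rho> \<boxtimes> ?A) \<cdot> (((\<rho> \<boxtimes> ?A) \<boxtimes> ?A) \<cdot> (?i (Assoc C (x \<otimes> ?a) ?a ?a) \<cdot> (((?X \<boxtimes> ?A) \<boxtimes> \<sigma>) \<cdot> ?i ?as)))"
    using assoc_inv_nat[of ?X ?A \<sigma> x ?a "?a \<otimes> ?a"] t by simp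
  also have "\<dots> = (\<rho> \<boxtimes> ?A) \<cdot> (?i ?as \<cdot> ((\<rho> \<boxtimes> (?A \<boxtimes> ?A)) \<cdot> (((?X \<boxtimes> ?A) \<boxtimes> \<sigma>) \<cdot> ?i ?as)))"
    using assoc_inv_nat_chain[of \<rho> ?A ?A x ?a ?a "((?X \<boxtimes> ?A) \<boxtimes> \<sigma>) \<cdot> ?i ?as"] t by simp
  also have "\<dots> = U \<cdot> ((\<rho> \<boxtimes> ?A) \<cdot> ?i ?as)" using t by (simp add: U_def)
  finally have U3: "U \<cdot> (?X \<boxtimes> ?m) = U \<cdot> ((\<rho> \<boxtimes> ?A) \<cdot> ?i ?as)" .
  have "U \<cdot> RUnit C (x \<otimes> ?a) = U \<cdot> ((?X \<boxtimes> RUnit C ?a) \<cdot> Assoc C x ?a \<one>)"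
    using t by (simp add: runit_tens)
  also have "\<dots> = U \<cdot> ((?X \<boxtimes> (?m \<cdot> (?A \<boxtimes> rone R))) \<cdot> Assoc C x ?a \<one>)"
    by (simp only: ring_laws(4)[OF R])
  also have "\<dots> = (U \<cdot> (?X \<boxtimes> ?m)) \<cdot> ((?X \<boxtimes> (?A \<boxtimes> rone R)) \<cdot> Assoc C x ?a \<one>)"
    using t U by simp
  also have "\<dots> = (U \<cdot> ((\<rho> \<boxtimes> ?A) \<cdot> ?i ?as)) \<cdot> (?as \<cdot> ((?X \<boxtimes> ?A) \<boxtimes> rone R))"
    unfolding U3 using assoc_nat[of ?X ?A "rone R" x ?a ?a] t U by simp
  also have "\<dots> = (U \<cdot> (?X \<boxtimes> rone R)) \<cdot> (\<rho> \<boxtimes> Id C \<one>)" using t U by simp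
  also have "\<dots> = (\<tau> \<cdot> \<rho>) \<cdot> RUnit C (x \<otimes> ?a)"
    unfolding \<tau>r[symmetric] using t \<tau> runit_nat[of \<rho> x] by simp
  finally have e5: "U \<cdot> RUnit C (x \<otimes> ?a) = (\<tau> \<cdot> \<rho>) \<cdot> RUnit C (x \<otimes> ?a)" .
  have U5: "U = \<tau> \<cdot> \<rho>"
    by (rule iso_epi[OF _ _ _ _ _ e5]) (use t \<tau> U in simp_all)
  show ?thesis by (rule that[OF \<tau> \<rho>\<tau>]) (use U4 U5 in simp)
qed

text \<open>The section \<open>\<tau>\<close> of the action on \<open>x\<close> yields the endomorphism \<open>e : x \<otimes> y \<mapsto> x\<sigma>\<^sub>1 \<otimes> \<sigma>\<^sub>2y\<close>.  It is balanced,
  hence factors through the coequaliser as \<open>e = s \<cdot> q\<close>.  Conversely \<open>q \<cdot> e = q\<close>, because \<open>q\<close> allows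
  moving \<open>\<sigma>\<^sub>2\<close> back and \<open>\<tau>\<close> is a section, so that \<open>s\<close> is a section of \<open>q\<close>.\<close>

lemma separable_coequaliser_split:
  assumes sep: "separable_ring C R" and x: "x \<in> Ob C"
    and \<rho>: "\<rho> \<in> hom C (x \<otimes> rob R) x"
    and \<rho>_assoc: "\<rho> \<cdot> (\<rho> \<boxtimes> Id C (rob R)) = \<rho> \<cdot> ((Id C x \<boxtimes> rmul R) \<cdot> Assoc C x (rob R) (rob R))"
    and \<rho>_one: "\<rho> \<cdot> (Id C x \<boxtimes> rone R) = RUnit C x"
    and Y: "left_module C R (y, \<kappa>)"
    and q: "coequaliser C (\<rho> \<boxtimes> Id C y) ((Id C x \<boxtimes> \<kappa>) \<cdot> Assoc C x (rob R) y) q"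
  obtains s where "s \<in> hom C (Cod C q) (Dom C q)" "q \<cdot> s = Id C (Cod C q)"
proof -
  let ?a = "rob R" and ?m = "rmul R" and ?A = "Id C (rob R)" and ?X = "Id C x"
  have R: "ring C R" using sep by (simp add: separable_ring_def)
  have y: "y \<in> Ob C" and \<kappa>: "\<kappa> \<in> hom C (?a \<otimes> y) y"
    and \<kappa>_assoc: "\<kappa> \<cdot> (?m \<boxtimes> Id C y) = \<kappa> \<cdot> (?A \<boxtimes> \<kappa>) \<cdot> Assoc C ?a ?a y"
    using Y unfolding left_module_def Let_def by auto
  obtain \<tau> where \<tau>: "\<tau> \<in> hom C x (x \<otimes> ?a)" and \<rho>\<tau>: "\<rho> \<cdot> \<tau> = ?X"
    and \<tau>\<rho>: "\<tau> \<cdot> \<rho> = (?X \<boxtimes> ?m) \<cdot> (Assoc C x ?a ?a \<cdot> (\<tau> \<boxtimes> ?A))"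
    using separable_section[OF sep x \<rho> \<rho>_assoc \<rho>_one] by blast
  note t = R x \<rho> y \<kappa> \<tau>
  have qt: "q \<in> Arr C" "Dom C q = x \<otimes> y"
    and qeq: "q \<cdot> (\<rho> \<boxtimes> Id C y) = q \<cdot> ((?X \<boxtimes> \<kappa>) \<cdot> Assoc C x ?a y)"
    using q t unfolding coequaliser_def by auto
  let ?r = "(?X \<boxtimes> \<kappa>) \<cdot> Assoc C x ?a y"
  let ?e = "?r \<cdot> (\<tau> \<boxtimes> Id C y)"
  have "q \<cdot> ?e = (q \<cdot> ?r) \<cdot> (\<tau> \<boxtimes> Id C y)" using t qt by simp
  also have "\<dots> = q \<cdot> ((\<rho> \<cdot> \<tau>) \<boxtimes> Id C y)" unfolding qeq[symmetric] using t qt by simp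
  also have "\<dots> = q" unfolding \<rho>\<tau> using t qt by simp
  finally have qe: "q \<cdot> ?e = q" .
  have "?e \<cdot> ?r = (?X \<boxtimes> \<kappa>) \<cdot> ((Assoc C x ?a y \<cdot> ((?X \<boxtimes> ?A) \<boxtimes> \<kappa>)) \<cdot> ((\<tau> \<boxtimes> (?A \<boxtimes> Id C y)) \<cdot> Assoc C x ?a y))"
    using t by simp
  also have "\<dots> = (?X \<boxtimes> \<kappa>) \<cdot> (((?X \<boxtimes> (?A \<boxtimes> \<kappa>)) \<cdot> Assoc C x ?a (?a \<otimes> y)) \<cdot> (Assoc C (x \<otimes> ?a) ?a y \<cdot> ((\<tau> \<boxtimes> ?A) \<boxtimes> Id C y)))"
    using assoc_nat[of ?X ?A \<kappa> x ?a y] assoc_nat[of \<tau> ?A "Id C y" "x \<otimes> ?a" ?a y] t by simp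
  also have "\<dots> = (?X \<boxtimes> (\<kappa> \<cdot> (?A \<boxtimes> \<kappa>))) \<cdot> ((Assoc C x ?a (?a \<otimes> y) \<cdot> Assoc C (x \<otimes> ?a) ?a y) \<cdot> ((\<tau> \<boxtimes> ?A) \<boxtimes> Id C y))"
    using t by simp
  also have "\<dots> = (?X \<boxtimes> (\<kappa> \<cdot> (?A \<boxtimes> \<kappa>))) \<cdot> (((?X \<boxtimes> Assoc C ?a ?a y) \<cdot> Assoc C x (?a \<otimes> ?a) y \<cdot> (Assoc C x ?a ?a \<boxtimes> Id C y)) \<cdot> ((\<tau> \<boxtimes> ?A) \<boxtimes> Id C y))"
    using t by (simp only: pentagon ring_typing(1))
  also have "\<dots> = (?X \<boxtimes> (\<kappa> \<cdot> (?A \<boxtimes> \<kappa>) \<cdot> Assoc C ?a ?a y)) \<cdot> (Assoc C x (?a \<otimes> ?a) y \<cdot> ((Assoc C x ?a ?a \<cdot> (\<tau> \<boxtimes> ?A)) \<boxtimes> Id C y))"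
    using t by simp
  also have "\<dots> = (?X \<boxtimes> \<kappa>) \<cdot> ((?X \<boxtimes> (?m \<boxtimes> Id C y)) \<cdot> (Assoc C x (?a \<otimes> ?a) y \<cdot> ((Assoc C x ?a ?a \<cdot> (\<tau> \<boxtimes> ?A)) \<boxtimes> Id C y)))"
    using t by (simp only: \<kappa>_assoc[symmetric]) simp
  also have "\<dots> = (?X \<boxtimes> \<kappa>) \<cdot> (Assoc C x ?a y \<cdot> (((?X \<boxtimes> ?m) \<boxtimes> Id C y) \<cdot> ((Assoc C x ?a ?a \<cdot> (\<tau> \<boxtimes> ?A)) \<boxtimes> Id C y)))"
    using assoc_nat_chain[of ?X ?m "Id C y" x ?a y "(Assoc C x ?a ?a \<cdot> (\<tau> \<boxtimes> ?A)) \<boxtimes> Id C y"] t by simp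
  also have "\<dots> = ?r \<cdot> (((?X \<boxtimes> ?m) \<cdot> (Assoc C x ?a ?a \<cdot> (\<tau> \<boxtimes> ?A))) \<boxtimes> Id C y)"
    using t by simp
  also have "\<dots> = ?r \<cdot> ((\<tau> \<cdot> \<rho>) \<boxtimes> Id C y)" by (simp only: \<tau>\<rho>)
  also have "\<dots> = ?e \<cdot> (\<rho> \<boxtimes> Id C y)" using t by simp
  finally have er: "?e \<cdot> (\<rho> \<boxtimes> Id C y) = ?e \<cdot> ?r" by simp
  obtain s where s: "s \<in> hom C (Cod C q) (Cod C ?e)" "s \<cdot> q = ?e"
    by (rule coequaliser_factor[OF q _ _ er]) (use t in simp_all)
  have st: "s \<in> hom C (Cod C q) (Dom C q)" using s(1) t qt by simp
  have "(q \<cdot> s) \<cdot> q = q \<cdot> (s \<cdot> q)" using st qt by simp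
  also have "\<dots> = Id C (Cod C q) \<cdot> q" unfolding s(2) qe using qt by simp
  finally have qs: "(q \<cdot> s) \<cdot> q = Id C (Cod C q) \<cdot> q" .
  have "q \<cdot> s = Id C (Cod C q)"
    by (rule coequaliser_epi[OF q _ _ _ _ qs]) (use st qt in simp_all)
  then show ?thesis using that st by blast
qed

end

section \<open>Rings in a module category and algebras\<close>

locale separable_module_category = idempotent_complete_smc K
  for K :: "('o, 'm, 'x) moncat_scheme" (structure) +
  fixes R :: "('o, 'm) ring_data"
    and M :: "('o \<times> 'm, ('o, 'm) mod_arr) moncat"
    and q :: "'o \<times> 'm \<Rightarrow> 'o \<times> 'm \<Rightarrow> 'm"
  assumes separable: "separable_ring K R"
    and modules: "module_category K R M q"
begin

sublocale M: idempotent_complete_smc M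
  using modules by (simp add: module_category_def)

lemma ring_R [simp]: "ring K R"
  using separable by (simp add: separable_ring_def)

lemma und_simp [simp]: "und (X, f, Y) = f"
  by (simp add: und_def)

lemma mod_fields:
  "Ob M = Ob (Mod K R)" "Arr M = Arr (Mod K R)" "Dom M = Dom (Mod K R)" "Cod M = Cod (Mod K R)"
  "Id M = Id (Mod K R)" "Comp M = Comp (Mod K R)" "Zero M = Zero (Mod K R)"
proof -
  have "addcat.truncate M = Mod K R" using modules by (simp add: module_category_def)
  note eq = this[symmetric, unfolded addcat.truncate_def]
  show "Ob M = Ob (Mod K R)" "Arr M = Arr (Mod K R)" "Dom M = Dom (Mod K R)" "Cod M = Cod (Mod K R)"
    "Id M = Id (Mod K R)" "Comp M = Comp (Mod K R)" "Zero M = Zero (Mod K R)"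
    by (simp_all add: eq)
qed

lemma mod_ob: "X \<in> Ob M \<longleftrightarrow> left_module K R X"
  by (simp add: mod_fields Mod_def)

lemma mod_dom_cod [simp]: "Dom M (X, f, Y) = X" "Cod M (X, f, Y) = Y"
  by (simp_all add: mod_fields Mod_def)

lemma und_ops [simp]:
  "und (Id M X) = Id K (fst X)" "und (G \<cdot>\<^bsub>M\<^esub> F) = und G \<cdot> und F" "und (Zero M X Y) = Zero K (fst X) (fst Y)"
  by (simp_all add: mod_fields Mod_def)

lemma mod_arr: "(X, f, Y) \<in> Arr M \<longleftrightarrow> left_module K R X \<and> left_module K R Y \<and> linear_arr K R X Y f"
  by (cases X; cases Y) (simp add: mod_fields Mod_def)

lemma mod_arr_eq: "F = (Dom M F, und F, Cod M F)"
  by (cases F) simp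

lemma mod_arr_eqI:
  "Dom M F = Dom M G \<Longrightarrow> Cod M F = Cod M G \<Longrightarrow> und F = und G \<Longrightarrow> F = G"
  using mod_arr_eq[of F] mod_arr_eq[of G] by simp

lemma mod_ob_typing [simp]:
  assumes "X \<in> Ob M"
  shows "fst X \<in> Ob K" "snd X \<in> Arr K" "Dom K (snd X) = rob R \<otimes> fst X" "Cod K (snd X) = fst X"
  using assms by (simp_all add: mod_ob left_module_def Let_def)

lemma und_typing [simp]:
  assumes "F \<in> Arr M"
  shows "und F \<in> Arr K" "Dom K (und F) = fst (Dom M F)" "Cod K (und F) = fst (Cod M F)"
proof -
  have "(Dom M F, und F, Cod M F) \<in> Arr M" using assms mod_arr_eq[of F] by simp
  then show "und F \<in> Arr K" "Dom K (und F) = fst (Dom M F)" "Cod K (und F) = fst (Cod M F)"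
    unfolding mod_arr by (auto simp: linear_arr_def)
qed

lemma unit_mod: "\<one>\<^bsub>M\<^esub> = (rob R, rmul R)"
  using modules by (simp add: module_category_def regular_module_def)

lemma tensor_coequaliser:
  assumes "X \<in> Ob M" "Y \<in> Ob M"
  shows "coequaliser K (act_left K R X Y) (act_right K R X Y) (q X Y)"
  using modules assms unfolding module_category_def by blast

lemma tensor_typing [simp]:
  assumes "X \<in> Ob M" "Y \<in> Ob M"
  shows "q X Y \<in> Arr K" "Dom K (q X Y) = fst X \<otimes> fst Y" "Cod K (q X Y) = fst (X \<otimes>\<^bsub>M\<^esub> Y)"
proof -
  have "Cod K (act_left K R X Y) = fst X \<otimes> fst Y"
    using assms by (simp add: act_left_def right_action_def)
  then show "q X Y \<in> Arr K" "Dom K (q X Y) = fst X \<otimes> fst Y"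
    using tensor_coequaliser[OF assms] unfolding coequaliser_def by simp_all
  show "Cod K (q X Y) = fst (X \<otimes>\<^bsub>M\<^esub> Y)"
    using modules assms unfolding module_category_def by blast
qed

lemma tensor_epi:
  assumes "X \<in> Ob M" "Y \<in> Ob M" "u \<in> Arr K" "v \<in> Arr K" "Dom K u = fst (X \<otimes>\<^bsub>M\<^esub> Y)"
    "Dom K v = fst (X \<otimes>\<^bsub>M\<^esub> Y)" "u \<cdot> q X Y = v \<cdot> q X Y"
  shows "u = v"
  by (rule coequaliser_epi[OF tensor_coequaliser[OF assms(1,2)] assms(3,4) _ _ assms(7)])
    (use assms in simp_all)

lemma tensor_action:
  assumes "X \<in> Ob M" "Y \<in> Ob M"
  shows "snd (X \<otimes>\<^bsub>M\<^esub> Y) \<cdot> (Id K (rob R) \<boxtimes> q X Y) =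
    q X Y \<cdot> ((snd X \<boxtimes> Id K (fst Y)) \<cdot> inverse_arr K (Assoc K (rob R) (fst X) (fst Y)))"
  using modules assms unfolding module_category_def by blast

lemma tensor_swap:
  assumes "X \<in> Ob M" "Y \<in> Ob M"
  shows "und (Swap M X Y) \<cdot> q X Y = q Y X \<cdot> Swap K (fst X) (fst Y)"
  using modules assms unfolding module_category_def by blast

lemma tensor_arr:
  assumes "F \<in> Arr M" "G \<in> Arr M"
  shows "und (F \<boxtimes>\<^bsub>M\<^esub> G) \<cdot> q (Dom M F) (Dom M G) = q (Cod M F) (Cod M G) \<cdot> (und F \<boxtimes> und G)"
  using modules assms unfolding module_category_def by blast

lemma tensor_units:
  assumes "X \<in> Ob M"
  shows "und (LUnit M X) \<cdot> q \<one>\<^bsub>M\<^esub> X = snd X" "und (RUnit M X) \<cdot> q X \<one>\<^bsub>M\<^esub> = right_action K R X"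
  using modules assms unfolding module_category_def by blast+

lemma tensor_assoc:
  assumes "X \<in> Ob M" "Y \<in> Ob M" "Z \<in> Ob M"
  shows "und (Assoc M X Y Z) \<cdot> (q (X \<otimes>\<^bsub>M\<^esub> Y) Z \<cdot> (q X Y \<boxtimes> Id K (fst Z))) =
    q X (Y \<otimes>\<^bsub>M\<^esub> Z) \<cdot> ((Id K (fst X) \<boxtimes> q Y Z) \<cdot> Assoc K (fst X) (fst Y) (fst Z))"
  using modules assms unfolding module_category_def by blast

lemma underlying_ring_simps [simp]:
  "rob (underlying_ring K R q \<beta>) = fst (rob \<beta>)"
  "rmul (underlying_ring K R q \<beta>) = und (rmul \<beta>) \<cdot> q (rob \<beta>) (rob \<beta>)"
  "rone (underlying_ring K R q \<beta>) = und (rone \<beta>) \<cdot> rone R"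
  by (simp_all add: underlying_ring_def)

text \<open>In a ring in the module category the scalars act through the unit: this is the left unit law,
  read in the ambient category.  It makes a morphism of algebras automatically linear.\<close>

lemma action_via_unit:
  assumes \<beta>: "ring M \<beta>"
  shows "snd (rob \<beta>) = rmul (underlying_ring K R q \<beta>) \<cdot> (und (rone \<beta>) \<boxtimes> Id K (fst (rob \<beta>)))"
proof -
  let ?X = "rob \<beta>"
  have X: "?X \<in> Ob M" using \<beta> by simp
  have "und (rmul \<beta> \<cdot>\<^bsub>M\<^esub> (rone \<beta> \<boxtimes>\<^bsub>M\<^esub> Id M ?X)) = und (LUnit M ?X)"
    by (simp only: M.ring_laws(3)[OF \<beta>])
  then have u: "und (rmul \<beta>) \<cdot> und (rone \<beta> \<boxtimes>\<^bsub>M\<^esub> Id M ?X) = und (LUnit M ?X)" by simp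
  have "snd ?X = und (LUnit M ?X) \<cdot> q \<one>\<^bsub>M\<^esub> ?X" using tensor_units(1)[OF X] by simp
  also have "\<dots> = und (rmul \<beta>) \<cdot> (und (rone \<beta> \<boxtimes>\<^bsub>M\<^esub> Id M ?X) \<cdot> q \<one>\<^bsub>M\<^esub> ?X)"
    unfolding u[symmetric] using \<beta> X by simp
  also have "\<dots> = und (rmul \<beta>) \<cdot> (q ?X ?X \<cdot> (und (rone \<beta>) \<boxtimes> Id K (fst ?X)))"
    using tensor_arr[of "rone \<beta>" "Id M ?X"] \<beta> X by simp
  finally show ?thesis using \<beta> X by (simp add: unit_mod)
qed

text \<open>Together with the next lemma: ring morphisms in the module category are the ring morphisms of the
  underlying algebras that commute with the structure morphisms.\<close>

lemma underlying_ring_morphism: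
  assumes \<beta>: "ring M \<beta>" and \<gamma>: "ring M \<gamma>" and F: "ring_morphism M \<beta> \<gamma> F"
  shows "ring_morphism K (underlying_ring K R q \<beta>) (underlying_ring K R q \<gamma>) (und F)"
    and "und F \<cdot> und (rone \<beta>) = und (rone \<gamma>)"
proof -
  let ?X = "rob \<beta>" and ?Y = "rob \<gamma>"
  note t = \<beta> \<gamma> M.ring_morphism_typing[OF F]
  have u: "und F \<cdot> und (rmul \<beta>) = und (rmul \<gamma>) \<cdot> und (F \<boxtimes>\<^bsub>M\<^esub> F)"
    using arg_cong[OF M.ring_morphism_laws(1)[OF F], of und] by simp
  have "und F \<cdot> (und (rmul \<beta>) \<cdot> q ?X ?X) = (und F \<cdot> und (rmul \<beta>)) \<cdot> q ?X ?X"
    using t by simp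
  also have "\<dots> = und (rmul \<gamma>) \<cdot> (und (F \<boxtimes>\<^bsub>M\<^esub> F) \<cdot> q ?X ?X)" unfolding u using t by simp
  also have "\<dots> = und (rmul \<gamma>) \<cdot> (q ?Y ?Y \<cdot> (und F \<boxtimes> und F))"
    using tensor_arr[of F F] t by simp
  also have "\<dots> = (und (rmul \<gamma>) \<cdot> q ?Y ?Y) \<cdot> (und F \<boxtimes> und F)" using t by simp
  finally have mul: "und F \<cdot> (und (rmul \<beta>) \<cdot> q ?X ?X) = (und (rmul \<gamma>) \<cdot> q ?Y ?Y) \<cdot> (und F \<boxtimes> und F)" .
  show one: "und F \<cdot> und (rone \<beta>) = und (rone \<gamma>)"
    using arg_cong[OF M.ring_morphism_laws(2)[OF F], of und] by simp
  have "und F \<cdot> (und (rone \<beta>) \<cdot> rone R) = (und F \<cdot> und (rone \<beta>)) \<cdot> rone R"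
    using t by (simp add: unit_mod)
  then show "ring_morphism K (underlying_ring K R q \<beta>) (underlying_ring K R q \<gamma>) (und F)"
    unfolding ring_morphism_def underlying_ring_simps mul one using t by simp
qed

lemma algebra_morphism_lift:
  assumes \<beta>: "ring M \<beta>" and \<gamma>: "ring M \<gamma>"
    and f: "ring_morphism K (underlying_ring K R q \<beta>) (underlying_ring K R q \<gamma>) f"
    and over: "f \<cdot> und (rone \<beta>) = und (rone \<gamma>)"
  shows "ring_morphism M \<beta> \<gamma> (rob \<beta>, f, rob \<gamma>)"
proof -
  let ?X = "rob \<beta>" and ?Y = "rob \<gamma>" and ?F = "(rob \<beta>, f, rob \<gamma>)"
  let ?mb = "rmul (underlying_ring K R q \<beta>)" and ?mc = "rmul (underlying_ring K R q \<gamma>)"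
  have ft: "f \<in> hom K (fst ?X) (fst ?Y)" using ring_morphism_typing[OF f] by simp
  note t = \<beta> \<gamma> ft
  have mbt: "?mb \<in> hom K (fst ?X \<otimes> fst ?X) (fst ?X)" "?mc \<in> hom K (fst ?Y \<otimes> fst ?Y) (fst ?Y)"
    using t by simp_all
  have "f \<cdot> snd ?X = f \<cdot> (?mb \<cdot> (und (rone \<beta>) \<boxtimes> Id K (fst ?X)))"
    by (simp only: action_via_unit[OF \<beta>])
  also have "\<dots> = (f \<cdot> ?mb) \<cdot> (und (rone \<beta>) \<boxtimes> Id K (fst ?X))"
    by (rule comp_assoc'[symmetric]) (use t mbt in \<open>simp_all add: unit_mod del: underlying_ring_simps\<close>)
  also have "\<dots> = (?mc \<cdot> (f \<boxtimes> f)) \<cdot> (und (rone \<beta>) \<boxtimes> Id K (fst ?X))"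
    by (simp only: ring_morphism_laws(1)[OF f])
  also have "\<dots> = ?mc \<cdot> ((f \<cdot> und (rone \<beta>)) \<boxtimes> f)"
    using t mbt by (simp add: unit_mod del: underlying_ring_simps)
  also have "\<dots> = (?mc \<cdot> (und (rone \<gamma>) \<boxtimes> Id K (fst ?Y))) \<cdot> (Id K (rob R) \<boxtimes> f)"
    unfolding over using t mbt by (simp add: unit_mod del: underlying_ring_simps)
  also have "\<dots> = snd ?Y \<cdot> (Id K (rob R) \<boxtimes> f)" by (simp only: action_via_unit[OF \<gamma>])
  finally have lin: "f \<cdot> snd ?X = snd ?Y \<cdot> (Id K (rob R) \<boxtimes> f)" .
  have F: "?F \<in> Arr M"
    using t lin M.ring_typing(1)[OF \<beta>] M.ring_typing(1)[OF \<gamma>]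
    unfolding mod_arr linear_arr_def mod_ob by blast
  note t = t F
  have mul: "?F \<cdot>\<^bsub>M\<^esub> rmul \<beta> = rmul \<gamma> \<cdot>\<^bsub>M\<^esub> (?F \<boxtimes>\<^bsub>M\<^esub> ?F)"
  proof (rule mod_arr_eqI)
    have "(f \<cdot> und (rmul \<beta>)) \<cdot> q ?X ?X = f \<cdot> ?mb" using t by simp
    also have "\<dots> = ?mc \<cdot> (f \<boxtimes> f)" by (simp only: ring_morphism_laws(1)[OF f])
    also have "\<dots> = und (rmul \<gamma>) \<cdot> (q ?Y ?Y \<cdot> (f \<boxtimes> f))" using t by simp
    also have "\<dots> = und (rmul \<gamma>) \<cdot> (und (?F \<boxtimes>\<^bsub>M\<^esub> ?F) \<cdot> q ?X ?X)"
      using tensor_arr[OF F F] by simp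
    also have "\<dots> = (und (rmul \<gamma>) \<cdot> und (?F \<boxtimes>\<^bsub>M\<^esub> ?F)) \<cdot> q ?X ?X" using t by simp
    finally have eq: "(f \<cdot> und (rmul \<beta>)) \<cdot> q ?X ?X = (und (rmul \<gamma>) \<cdot> und (?F \<boxtimes>\<^bsub>M\<^esub> ?F)) \<cdot> q ?X ?X" .
    have "f \<cdot> und (rmul \<beta>) = und (rmul \<gamma>) \<cdot> und (?F \<boxtimes>\<^bsub>M\<^esub> ?F)"
      by (rule tensor_epi[OF _ _ _ _ _ _ eq]) (use t in simp_all)
    then show "und (?F \<cdot>\<^bsub>M\<^esub> rmul \<beta>) = und (rmul \<gamma> \<cdot>\<^bsub>M\<^esub> (?F \<boxtimes>\<^bsub>M\<^esub> ?F))" by simp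
  qed (use t in simp_all)
  have "?F \<cdot>\<^bsub>M\<^esub> rone \<beta> = rone \<gamma>"
    by (rule mod_arr_eqI) (use t over in simp_all)
  with mul F show ?thesis unfolding ring_morphism_def by simp
qed

text \<open>An endomorphism that is linear over a ring in the module category is also linear over the underlying
  ring.\<close>

lemma trivial_idempotents_lift:
  assumes \<beta>: "ring M \<beta>" and idem: "trivial_idempotents K (underlying_ring K R q \<beta>)"
  shows "trivial_idempotents M \<beta>"
  unfolding trivial_idempotents_def
proof (intro allI impI, elim conjE)
  let ?X = "rob \<beta>" and ?U = "underlying_ring K R q \<beta>"
  fix E assume lin: "linear_arr M \<beta> (regular_module \<beta>) (regular_module \<beta>) E"
    and EE: "E \<cdot>\<^bsub>M\<^esub> E = E"
  have E: "E \<in> hom M ?X ?X" and Em: "E \<cdot>\<^bsub>M\<^esub> rmul \<beta> = rmul \<beta> \<cdot>\<^bsub>M\<^esub> (Id M ?X \<boxtimes>\<^bsub>M\<^esub> E)"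
    using lin unfolding linear_arr_def regular_module_def by simp_all
  note t = \<beta> E
  have u: "und E \<cdot> und (rmul \<beta>) = und (rmul \<beta>) \<cdot> und (Id M ?X \<boxtimes>\<^bsub>M\<^esub> E)"
    using arg_cong[OF Em, of und] by simp
  have "und E \<cdot> rmul ?U = (und E \<cdot> und (rmul \<beta>)) \<cdot> q ?X ?X" using t by simp
  also have "\<dots> = und (rmul \<beta>) \<cdot> (und (Id M ?X \<boxtimes>\<^bsub>M\<^esub> E) \<cdot> q ?X ?X)" unfolding u using t by simp
  also have "\<dots> = rmul ?U \<cdot> (Id K (fst ?X) \<boxtimes> und E)"
    using tensor_arr[of "Id M ?X" E] t by simp
  finally have "linear_arr K ?U (regular_module ?U) (regular_module ?U) (und E)"
    using t by (simp add: linear_arr_def regular_module_def)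
  moreover have "und E \<cdot> und E = und E" using arg_cong[OF EE, of und] by simp
  ultimately have "und E = Id K (fst ?X) \<or> und E = Zero K (fst ?X) (fst ?X)"
    using idem unfolding trivial_idempotents_def by simp
  then show "E = Id M ?X \<or> E = Zero M ?X ?X"
    using t by (auto intro!: mod_arr_eqI)
qed

text \<open>The multiplication of an \<open>R\<close>-algebra is balanced, so it descends along the coequaliser \<open>Q\<close> of
  \<open>B \<otimes> B\<close> to an arrow \<open>k\<close>.  Each ring axiom for \<open>k\<close> is the corresponding axiom for \<open>B\<close> after
  composition with the coequalisers.  Linearity and associativity involve \<open>1 \<otimes> Q\<close> and \<open>Q \<otimes> 1\<close>, which
  can be cancelled because \<open>Q\<close> has a section.\<close>

lemma algebra_as_ring_in_modules:
  assumes B: "ring K B" and g: "ring_morphism K R B g"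
  obtains \<beta> where "ring M \<beta>" "underlying_ring K R q \<beta> = B" "und (rone \<beta>) = g"
proof -
  let ?a = "rob R" and ?b = "rob B" and ?m = "rmul B" and ?A = "Id K (rob R)" and ?I = "Id K (rob B)"
  let ?\<rho> = "?m \<cdot> (g \<boxtimes> ?I)" and ?\<rho>' = "?m \<cdot> (?I \<boxtimes> g)"
  define X where "X = (?b, ?\<rho>)"
  have X_simps [simp]: "fst X = ?b" "snd X = ?\<rho>" by (simp_all add: X_def)
  note gt = ring_morphism_typing[OF g]
  note t = B ring_R gt
  have left: "left_module K R X"
  proof -
    have "?\<rho> \<cdot> (rmul R \<boxtimes> ?I) = ?m \<cdot> ((g \<cdot> rmul R) \<boxtimes> ?I)" using t by simp
    also have "\<dots> = ?m \<cdot> ((?m \<cdot> (g \<boxtimes> g)) \<boxtimes> ?I)" by (simp only: ring_morphism_laws(1)[OF g])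
    also have "\<dots> = ?m \<cdot> ((g \<boxtimes> (?m \<cdot> (g \<boxtimes> ?I))) \<cdot> Assoc K ?a ?a ?b)"
      using t by (intro mult_assoc) simp_all
    also have "\<dots> = ?\<rho> \<cdot> ((?A \<boxtimes> ?\<rho>) \<cdot> Assoc K ?a ?a ?b)" using t by simp
    finally have assoc: "?\<rho> \<cdot> (rmul R \<boxtimes> ?I) = ?\<rho> \<cdot> ((?A \<boxtimes> ?\<rho>) \<cdot> Assoc K ?a ?a ?b)" .
    have "?\<rho> \<cdot> (rone R \<boxtimes> ?I) = ?m \<cdot> ((g \<cdot> rone R) \<boxtimes> ?I)" using t by simp
    also have "\<dots> = LUnit K ?b" by (simp only: ring_morphism_laws(2)[OF g] ring_laws(3)[OF B])
    finally have "?\<rho> \<cdot> (rone R \<boxtimes> ?I) = LUnit K ?b" .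
    moreover have "?\<rho> \<in> hom K (?a \<otimes> ?b) ?b" "?b \<in> Ob K" using t by simp_all
    ultimately show ?thesis
      unfolding left_module_def Let_def X_simps using assoc by blast
  qed
  have X: "X \<in> Ob M" using left by (simp only: mod_ob)
  let ?Q = "q X X" and ?XX = "X \<otimes>\<^bsub>M\<^esub> X"
  have right: "right_action K R X = ?\<rho>'"
    using mult_swap[OF B, of ?I ?b g ?a] t by (simp add: right_action_def)
  obtain s where s: "s \<in> hom K (fst ?XX) (?b \<otimes> ?b)" and Qs: "?Q \<cdot> s = Id K (fst ?XX)"
  proof (rule separable_coequaliser_split[OF separable])
    show "?b \<in> Ob K" "?\<rho>' \<in> hom K (?b \<otimes> ?a) ?b" using t by simp_all
    have "?\<rho>' \<cdot> (?\<rho>' \<boxtimes> ?A) = ?m \<cdot> ((?m \<cdot> (?I \<boxtimes> g)) \<boxtimes> g)" using t by simp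
    also have "\<dots> = ?m \<cdot> ((?I \<boxtimes> (?m \<cdot> (g \<boxtimes> g))) \<cdot> Assoc K ?b ?a ?a)"
      using t by (intro mult_assoc) simp_all
    also have "\<dots> = ?m \<cdot> ((?I \<boxtimes> (g \<cdot> rmul R)) \<cdot> Assoc K ?b ?a ?a)"
      by (simp only: ring_morphism_laws(1)[OF g])
    also have "\<dots> = ?\<rho>' \<cdot> ((?I \<boxtimes> rmul R) \<cdot> Assoc K ?b ?a ?a)" using t by simp
    finally show "?\<rho>' \<cdot> (?\<rho>' \<boxtimes> ?A) = ?\<rho>' \<cdot> ((?I \<boxtimes> rmul R) \<cdot> Assoc K ?b ?a ?a)" .
    have "?\<rho>' \<cdot> (?I \<boxtimes> rone R) = ?m \<cdot> (?I \<boxtimes> (g \<cdot> rone R))" using t by simp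
    then show "?\<rho>' \<cdot> (?I \<boxtimes> rone R) = RUnit K ?b"
      by (simp only: ring_morphism_laws(2)[OF g] ring_laws(4)[OF B])
    show "left_module K R (?b, ?\<rho>)" using left by (simp only: X_def)
    show "coequaliser K (?\<rho>' \<boxtimes> ?I) ((?I \<boxtimes> ?\<rho>) \<cdot> Assoc K ?b ?a ?b) ?Q"
      using tensor_coequaliser[OF X X] unfolding act_left_def act_right_def right X_simps .
  qed (use X in simp)
  \<comment> \<open>The multiplication of \<open>B\<close> coequalises the two actions: \<open>(b g(r)) b' = b (g(r) b')\<close>.\<close>
  have "?m \<cdot> act_left K R X X = ?m \<cdot> ((?m \<cdot> (?I \<boxtimes> g)) \<boxtimes> ?I)"
    using t by (simp add: act_left_def right)
  also have "\<dots> = ?m \<cdot> ((?I \<boxtimes> (?m \<cdot> (g \<boxtimes> ?I))) \<cdot> Assoc K ?b ?a ?b)"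
    using t by (intro mult_assoc) simp_all
  also have "\<dots> = ?m \<cdot> act_right K R X X" by (simp add: act_right_def)
  finally have bal: "?m \<cdot> act_left K R X X = ?m \<cdot> act_right K R X X" .
  obtain k where k: "k \<in> hom K (fst ?XX) ?b" and kQ: "k \<cdot> ?Q = ?m"
  proof (rule coequaliser_factor[OF tensor_coequaliser[OF X X] _ _ bal])
    show "Dom K ?m = Cod K (act_left K R X X)" using t by (simp add: act_left_def right)
  qed (use t X in auto)
  have XX: "?XX \<in> Ob M" using X by simp
  note t = t X XX k s
  have klin: "k \<cdot> snd ?XX = ?\<rho> \<cdot> (?A \<boxtimes> k)"
  proof -
    have mult: "?m \<cdot> ((?m \<cdot> (g \<boxtimes> ?I)) \<boxtimes> ?I) = ?m \<cdot> ((g \<boxtimes> (?m \<cdot> (?I \<boxtimes> ?I))) \<cdot> Assoc K ?a ?b ?b)"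
      using t by (intro mult_assoc) simp_all
    have "(k \<cdot> snd ?XX) \<cdot> (?A \<boxtimes> ?Q) = k \<cdot> (snd ?XX \<cdot> (?A \<boxtimes> ?Q))" using t by simp
    also have "\<dots> = k \<cdot> (?Q \<cdot> ((?\<rho> \<boxtimes> ?I) \<cdot> inverse_arr K (Assoc K ?a ?b ?b)))"
      using tensor_action[OF X X] by simp
    also have "\<dots> = (k \<cdot> ?Q) \<cdot> ((?\<rho> \<boxtimes> ?I) \<cdot> inverse_arr K (Assoc K ?a ?b ?b))" using t by simp
    also have "\<dots> = (?m \<cdot> ((?m \<cdot> (g \<boxtimes> ?I)) \<boxtimes> ?I)) \<cdot> inverse_arr K (Assoc K ?a ?b ?b)"
      unfolding kQ using t by simp
    also have "\<dots> = (?m \<cdot> ((g \<boxtimes> (?m \<cdot> (?I \<boxtimes> ?I))) \<cdot> Assoc K ?a ?b ?b)) \<cdot> inverse_arr K (Assoc K ?a ?b ?b)"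
      by (simp only: mult)
    also have "\<dots> = ?m \<cdot> (g \<boxtimes> (k \<cdot> ?Q))" unfolding kQ using t by simp
    also have "\<dots> = (?\<rho> \<cdot> (?A \<boxtimes> k)) \<cdot> (?A \<boxtimes> ?Q)" using t by simp
    finally have eq: "(k \<cdot> snd ?XX) \<cdot> (?A \<boxtimes> ?Q) = (?\<rho> \<cdot> (?A \<boxtimes> k)) \<cdot> (?A \<boxtimes> ?Q)" .
    have "k \<cdot> snd ?XX = ((k \<cdot> snd ?XX) \<cdot> (?A \<boxtimes> ?Q)) \<cdot> (?A \<boxtimes> s)" using t Qs by simp
    also have "\<dots> = ((?\<rho> \<cdot> (?A \<boxtimes> k)) \<cdot> (?A \<boxtimes> ?Q)) \<cdot> (?A \<boxtimes> s)" by (simp only: eq)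
    also have "\<dots> = ?\<rho> \<cdot> (?A \<boxtimes> k)" using t Qs by simp
    finally show ?thesis .
  qed
  let ?mM = "(?XX, k, X)" and ?gM = "(\<one>\<^bsub>M\<^esub>, g, X)"
  have mM: "?mM \<in> Arr M"
    using klin k left XX unfolding mod_arr linear_arr_def mod_ob by simp
  have gM: "?gM \<in> Arr M"
  proof -
    have "g \<cdot> rmul R = ?m \<cdot> (g \<boxtimes> g)" by (rule ring_morphism_laws(1)[OF g])
    also have "\<dots> = ?\<rho> \<cdot> (?A \<boxtimes> g)" using t by simp
    finally show ?thesis
      using t left M.unit_ob unfolding mod_arr linear_arr_def mod_ob by (simp add: unit_mod)
  qed
  note t = t mM gM
  define \<beta> where "\<beta> = \<lparr>rob = X, rmul = ?mM, rone = ?gM\<rparr>"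
  have assoc: "?mM \<cdot>\<^bsub>M\<^esub> (?mM \<boxtimes>\<^bsub>M\<^esub> Id M X) = ?mM \<cdot>\<^bsub>M\<^esub> (Id M X \<boxtimes>\<^bsub>M\<^esub> ?mM) \<cdot>\<^bsub>M\<^esub> Assoc M X X X"
  proof (rule mod_arr_eqI)
    let ?l = "und (?mM \<boxtimes>\<^bsub>M\<^esub> Id M X)" and ?r = "und (Id M X \<boxtimes>\<^bsub>M\<^esub> ?mM)" and ?as = "und (Assoc M X X X)"
    let ?QQ = "q ?XX X \<cdot> (?Q \<boxtimes> ?I)"
    have "(k \<cdot> ?l) \<cdot> ?QQ = k \<cdot> ((?l \<cdot> q ?XX X) \<cdot> (?Q \<boxtimes> ?I))" using t by simp
    also have "\<dots> = k \<cdot> ((?Q \<cdot> (k \<boxtimes> ?I)) \<cdot> (?Q \<boxtimes> ?I))"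
      using tensor_arr[OF mM, of "Id M X"] t by simp
    also have "\<dots> = (k \<cdot> ?Q) \<cdot> ((k \<cdot> ?Q) \<boxtimes> ?I)" using t by simp
    also have "\<dots> = (k \<cdot> ?Q) \<cdot> ((?I \<boxtimes> (k \<cdot> ?Q)) \<cdot> Assoc K ?b ?b ?b)"
      unfolding kQ by (rule ring_laws(1)[OF B])
    also have "\<dots> = k \<cdot> ((?Q \<cdot> (?I \<boxtimes> k)) \<cdot> ((?I \<boxtimes> ?Q) \<cdot> Assoc K ?b ?b ?b))" using t by simp
    also have "\<dots> = k \<cdot> ((?r \<cdot> q X ?XX) \<cdot> ((?I \<boxtimes> ?Q) \<cdot> Assoc K ?b ?b ?b))"
      using tensor_arr[OF _ mM, of "Id M X"] t by simp
    also have "\<dots> = (k \<cdot> ?r) \<cdot> (q X ?XX \<cdot> ((?I \<boxtimes> ?Q) \<cdot> Assoc K ?b ?b ?b))" using t by simp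
    also have "\<dots> = (k \<cdot> ?r) \<cdot> (?as \<cdot> ?QQ)" using tensor_assoc[OF X X X] by simp
    also have "\<dots> = (k \<cdot> (?r \<cdot> ?as)) \<cdot> ?QQ" using t by simp
    finally have eq: "(k \<cdot> ?l) \<cdot> ?QQ = (k \<cdot> (?r \<cdot> ?as)) \<cdot> ?QQ" .
    have "(k \<cdot> ?l) \<cdot> q ?XX X = ((k \<cdot> ?l) \<cdot> ?QQ) \<cdot> (s \<boxtimes> ?I)" using t Qs by simp
    also have "\<dots> = ((k \<cdot> (?r \<cdot> ?as)) \<cdot> ?QQ) \<cdot> (s \<boxtimes> ?I)" by (simp only: eq)
    also have "\<dots> = (k \<cdot> (?r \<cdot> ?as)) \<cdot> q ?XX X" using t Qs by simp
    finally have eq': "(k \<cdot> ?l) \<cdot> q ?XX X = (k \<cdot> (?r \<cdot> ?as)) \<cdot> q ?XX X" .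
    have "k \<cdot> ?l = k \<cdot> (?r \<cdot> ?as)"
      by (rule tensor_epi[OF _ _ _ _ _ _ eq']) (use t in simp_all)
    then show "und (?mM \<cdot>\<^bsub>M\<^esub> (?mM \<boxtimes>\<^bsub>M\<^esub> Id M X)) = und (?mM \<cdot>\<^bsub>M\<^esub> (Id M X \<boxtimes>\<^bsub>M\<^esub> ?mM) \<cdot>\<^bsub>M\<^esub> Assoc M X X X)"
      by simp
  qed (use t in simp_all)
  have comm: "?mM \<cdot>\<^bsub>M\<^esub> Swap M X X = ?mM"
  proof (rule mod_arr_eqI)
    have "(k \<cdot> und (Swap M X X)) \<cdot> ?Q = k \<cdot> (und (Swap M X X) \<cdot> ?Q)" using t by simp
    also have "\<dots> = k \<cdot> (?Q \<cdot> Swap K ?b ?b)" using tensor_swap[OF X X] by simp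
    also have "\<dots> = (k \<cdot> ?Q) \<cdot> Swap K ?b ?b" using t by simp
    also have "\<dots> = k \<cdot> ?Q" unfolding kQ by (rule ring_laws(2)[OF B])
    finally have eq: "(k \<cdot> und (Swap M X X)) \<cdot> ?Q = k \<cdot> ?Q" .
    have "k \<cdot> und (Swap M X X) = k"
      by (rule tensor_epi[OF _ _ _ _ _ _ eq]) (use t in simp_all)
    then show "und (?mM \<cdot>\<^bsub>M\<^esub> Swap M X X) = und ?mM" by simp
  qed (use t in simp_all)
  have unit_l: "?mM \<cdot>\<^bsub>M\<^esub> (?gM \<boxtimes>\<^bsub>M\<^esub> Id M X) = LUnit M X"
  proof (rule mod_arr_eqI)
    let ?l = "und (?gM \<boxtimes>\<^bsub>M\<^esub> Id M X)"
    have "(k \<cdot> ?l) \<cdot> q \<one>\<^bsub>M\<^esub> X = k \<cdot> (?l \<cdot> q \<one>\<^bsub>M\<^esub> X)" using t by simp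
    also have "\<dots> = k \<cdot> (?Q \<cdot> (g \<boxtimes> ?I))" using tensor_arr[OF gM, of "Id M X"] t by simp
    also have "\<dots> = (k \<cdot> ?Q) \<cdot> (g \<boxtimes> ?I)" using t by simp
    also have "\<dots> = und (LUnit M X) \<cdot> q \<one>\<^bsub>M\<^esub> X" unfolding kQ tensor_units(1)[OF X] by simp
    finally have eq: "(k \<cdot> ?l) \<cdot> q \<one>\<^bsub>M\<^esub> X = und (LUnit M X) \<cdot> q \<one>\<^bsub>M\<^esub> X" .
    have "k \<cdot> ?l = und (LUnit M X)"
      by (rule tensor_epi[OF _ _ _ _ _ _ eq]) (use t in simp_all)
    then show "und (?mM \<cdot>\<^bsub>M\<^esub> (?gM \<boxtimes>\<^bsub>M\<^esub> Id M X)) = und (LUnit M X)" by simp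
  qed (use t in simp_all)
  have unit_r: "?mM \<cdot>\<^bsub>M\<^esub> (Id M X \<boxtimes>\<^bsub>M\<^esub> ?gM) = RUnit M X"
  proof (rule mod_arr_eqI)
    let ?l = "und (Id M X \<boxtimes>\<^bsub>M\<^esub> ?gM)"
    have "(k \<cdot> ?l) \<cdot> q X \<one>\<^bsub>M\<^esub> = k \<cdot> (?l \<cdot> q X \<one>\<^bsub>M\<^esub>)" using t by simp
    also have "\<dots> = k \<cdot> (?Q \<cdot> (?I \<boxtimes> g))" using tensor_arr[OF _ gM, of "Id M X"] t by simp
    also have "\<dots> = (k \<cdot> ?Q) \<cdot> (?I \<boxtimes> g)" using t by simp
    also have "\<dots> = und (RUnit M X) \<cdot> q X \<one>\<^bsub>M\<^esub>" unfolding kQ tensor_units(2)[OF X] right ..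
    finally have eq: "(k \<cdot> ?l) \<cdot> q X \<one>\<^bsub>M\<^esub> = und (RUnit M X) \<cdot> q X \<one>\<^bsub>M\<^esub>" .
    have "k \<cdot> ?l = und (RUnit M X)"
      by (rule tensor_epi[OF _ _ _ _ _ _ eq]) (use t in simp_all)
    then show "und (?mM \<cdot>\<^bsub>M\<^esub> (Id M X \<boxtimes>\<^bsub>M\<^esub> ?gM)) = und (RUnit M X)" by simp
  qed (use t in simp_all)
  have arrows: "?mM \<in> hom M ?XX X" "?gM \<in> hom M \<one>\<^bsub>M\<^esub> X" using t by simp_all
  show ?thesis
  proof
    show "ring M \<beta>"
      unfolding ring_def Let_def \<beta>_def ring_data.simps using X arrows assoc comm unit_l unit_r by blast
    show "underlying_ring K R q \<beta> = B"
      using kQ ring_morphism_laws(2)[OF g] by (simp add: underlying_ring_def \<beta>_def)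
    show "und (rone \<beta>) = g" by (simp add: \<beta>_def)
  qed
qed

end

section \<open>Counting extensions along the tower\<close>

context idempotent_complete_smc
begin

text \<open>This is \<open>splitting_algebra_extension\<close> in the category of \<open>R\<close>-modules, where the splitting algebra is
  formed.  Ring morphisms \<open>S \<rightarrow> B\<close> that restrict to \<open>g\<close> on \<open>R\<close> are ring morphisms there, once \<open>B\<close> is
  regarded as an \<open>R\<close>-algebra through \<open>g\<close>.\<close>

lemma relative_splitting_extension:
  assumes sep: "separable_ring C R" and split: "relative_splitting C R S f S' f'"
  obtains w where "\<And>B g k0 k1. \<lbrakk>ring C B; trivial_idempotents C B; ring_morphism C R B g;
      ring_morphism C S B k0; k0 \<cdot> f = g; ring_morphism C S B k1; k1 \<cdot> f = g; k0 \<noteq> k1\<rbrakk> \<Longrightarrow>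
    \<exists>\<psi>. ring_morphism C S' B \<psi> \<and> \<psi> \<cdot> f' = k0 \<and> \<psi> \<cdot> w = k1"
proof -
  obtain M q \<beta> \<beta>' \<phi> where M: "module_category C R M q" and \<beta>: "ring M \<beta>"
    and S: "underlying_ring C R q \<beta> = S" and f: "und (rone \<beta>) = f"
    and spl: "splitting_algebra M \<beta> \<beta>' \<phi>"
    and S': "underlying_ring C R q \<beta>' = S'" and f': "und \<phi> = f'"
    using split unfolding relative_splitting_def by blast
  interpret mods: separable_module_category C R M q
    using sep M idempotent_complete_smc_axioms
    by (simp add: separable_module_category_def separable_module_category_axioms_def)
  have \<beta>': "ring M \<beta>'" using spl by (simp add: splitting_algebra_def separable_ring_def)
  show ?thesis
  proof (rule mods.M.splitting_algebra_extension[OF \<beta> spl])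
    fix w
    assume ext: "\<And>\<gamma> k0 k1. \<lbrakk>ring M \<gamma>; trivial_idempotents M \<gamma>; ring_morphism M \<beta> \<gamma> k0;
      ring_morphism M \<beta> \<gamma> k1; k0 \<noteq> k1\<rbrakk> \<Longrightarrow>
      \<exists>\<psi>. ring_morphism M \<beta>' \<gamma> \<psi> \<and> \<psi> \<cdot>\<^bsub>M\<^esub> \<phi> = k0 \<and> \<psi> \<cdot>\<^bsub>M\<^esub> w = k1"
    show ?thesis
    proof (rule that[of "und w"])
      fix B g k0 k1
      assume B: "ring C B" "trivial_idempotents C B" and g: "ring_morphism C R B g"
        and k0: "ring_morphism C S B k0" "k0 \<cdot> f = g" and k1: "ring_morphism C S B k1" "k1 \<cdot> f = g"
        and ne: "k0 \<noteq> k1"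
      obtain \<gamma> where \<gamma>: "ring M \<gamma>" and UB: "underlying_ring C R q \<gamma> = B" and ug: "und (rone \<gamma>) = g"
        using mods.algebra_as_ring_in_modules[OF B(1) g] by blast
      have idem: "trivial_idempotents M \<gamma>"
        by (rule mods.trivial_idempotents_lift[OF \<gamma>]) (simp only: UB B(2))
      have lift: "ring_morphism M \<beta> \<gamma> (rob \<beta>, k, rob \<gamma>)" if "ring_morphism C S B k" "k \<cdot> f = g" for k
        using mods.algebra_morphism_lift[OF \<beta> \<gamma>, of k] that by (simp only: S UB f ug)
      have "(rob \<beta>, k0, rob \<gamma>) \<noteq> (rob \<beta>, k1, rob \<gamma>)" using ne by simp
      from ext[OF \<gamma> idem lift[OF k0] lift[OF k1] this]
      obtain \<psi> where \<psi>: "ring_morphism M \<beta>' \<gamma> \<psi>" and \<psi>\<phi>: "\<psi> \<cdot>\<^bsub>M\<^esub> \<phi> = (rob \<beta>, k0, rob \<gamma>)"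
        and \<psi>w: "\<psi> \<cdot>\<^bsub>M\<^esub> w = (rob \<beta>, k1, rob \<gamma>)" by blast
      have "ring_morphism C S' B (und \<psi>)"
        using mods.underlying_ring_morphism(1)[OF \<beta>' \<gamma> \<psi>] by (simp only: S' UB)
      moreover have "und \<psi> \<cdot> f' = k0" "und \<psi> \<cdot> und w = k1"
        using arg_cong[OF \<psi>\<phi>, of und] arg_cong[OF \<psi>w, of und] by (simp_all add: f')
      ultimately show "\<exists>\<psi>. ring_morphism C S' B \<psi> \<and> \<psi> \<cdot> f' = k0 \<and> \<psi> \<cdot> und w = k1" by blast
    qed
  qed
qed

text \<open>Such a morphism would be zero, so \<open>1 = 0\<close> in \<open>B\<close> and hence \<open>B = 0\<close>.\<close>

lemma no_ring_morphism_from_zero: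
  assumes Z: "ring C Z" "zero_object C (rob Z)" and B: "ring C B" "\<not> zero_object C (rob B)"
  shows "\<not> ring_morphism C Z B h"
proof
  assume h: "ring_morphism C Z B h"
  note t = Z(1) B(1) ring_morphism_typing[OF h]
  let ?z = "rob Z" and ?b = "rob B"
  have "\<exists>!f. f \<in> hom C ?z ?b" using Z B(1) unfolding zero_object_def by simp
  moreover have "h \<in> hom C ?z ?b" "Zero C ?z ?b \<in> hom C ?z ?b" using t by simp_all
  ultimately have h0: "h = Zero C ?z ?b" by blast
  have one: "rone B = Zero C \<one> ?b"
    unfolding ring_morphism_laws(2)[OF h, symmetric] h0 using t by simp
  have "LUnit C ?b = rmul B \<cdot> (rone B \<boxtimes> Id C ?b)" using ring_laws(3)[OF B(1)] ..
  also have "\<dots> = Zero C (\<one> \<otimes> ?b) ?b" unfolding one using t by (simp add: tens_zero_left)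
  finally have eq: "Id C ?b \<cdot> LUnit C ?b = Zero C ?b ?b \<cdot> LUnit C ?b" using t by simp
  have "Id C ?b = Zero C ?b ?b"
    by (rule iso_epi[OF _ _ _ _ _ eq]) (use t in simp_all)
  then show False using zero_object_if_id_zero[of ?b] B by simp
qed

text \<open>With one extension \<open>k\<close> fixed, every other extension is \<open>\<psi> \<cdot> w\<close> for an extension \<open>\<psi>\<close> of \<open>k\<close> to the
  next stage.\<close>

lemma card_algebra_morphisms_le:
  assumes tower: "splitting_tower C A T s" and zero: "zero_object C (rob (T (d + 1)))"
    and B: "ring C B" "\<not> zero_object C (rob B)" "trivial_idempotents C B"
  shows "\<lbrakk>n + j = d; ring_morphism C (T n) B g\<rbrakk> \<Longrightarrow>
    finite {h. ring_morphism C (T (n + 1)) B h \<and> h \<cdot> s n = g} \<and>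
    card {h. ring_morphism C (T (n + 1)) B h \<and> h \<cdot> s n = g} \<le> j"
proof (induction j arbitrary: n g)
  case 0
  have "ring C (T (d + 1))" using tower unfolding splitting_tower_def separable_ring_def by blast
  then have E: "{h. ring_morphism C (T (n + 1)) B h \<and> h \<cdot> s n = g} = {}"
    using no_ring_morphism_from_zero[OF _ zero B(1,2)] 0 by auto
  show ?case unfolding E by simp
next
  case (Suc j)
  let ?E = "{h. ring_morphism C (T (n + 1)) B h \<and> h \<cdot> s n = g}"
  show ?case
  proof (cases "?E = {}")
    case True
    show ?thesis unfolding True by simp
  next
    case False
    then obtain k where k: "ring_morphism C (T (n + 1)) B k" "k \<cdot> s n = g" by blast
    let ?F = "{h. ring_morphism C (T (n + 2)) B h \<and> h \<cdot> s (n + 1) = k}"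
    have F: "finite ?F" "card ?F \<le> j" using Suc.IH[of "n + 1" k] Suc.prems k by simp_all
    have sep: "separable_ring C (T n)"
      and rel: "relative_splitting C (T n) (T (n + 1)) (s n) (T (n + 2)) (s (n + 1))"
      using tower unfolding splitting_tower_def by blast+
    obtain w where w: "\<And>h. \<lbrakk>ring_morphism C (T (n + 1)) B h; h \<cdot> s n = g; k \<noteq> h\<rbrakk> \<Longrightarrow>
        \<exists>\<psi>. ring_morphism C (T (n + 2)) B \<psi> \<and> \<psi> \<cdot> s (n + 1) = k \<and> \<psi> \<cdot> w = h"
    proof (rule relative_splitting_extension[OF sep rel])
      fix w
      assume ext: "\<And>B g k0 k1. \<lbrakk>ring C B; trivial_idempotents C B; ring_morphism C (T n) B g;
          ring_morphism C (T (n + 1)) B k0; k0 \<cdot> s n = g; ring_morphism C (T (n + 1)) B k1;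
          k1 \<cdot> s n = g; k0 \<noteq> k1\<rbrakk> \<Longrightarrow>
        \<exists>\<psi>. ring_morphism C (T (n + 2)) B \<psi> \<and> \<psi> \<cdot> s (n + 1) = k0 \<and> \<psi> \<cdot> w = k1"
      show thesis by (rule that[OF ext[OF B(1,3) Suc.prems(2) k]])
    qed
    have sub: "?E \<subseteq> insert k ((\<lambda>\<psi>. \<psi> \<cdot> w) ` ?F)"
      using w by blast
    have fin: "finite (insert k ((\<lambda>\<psi>. \<psi> \<cdot> w) ` ?F))" using F by simp
    have "card ?E \<le> card (insert k ((\<lambda>\<psi>. \<psi> \<cdot> w) ` ?F))" by (rule card_mono[OF fin sub])
    also have "\<dots> \<le> Suc (card ((\<lambda>\<psi>. \<psi> \<cdot> w) ` ?F))" by (rule card_insert_le_m1) simp_all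
    also have "\<dots> \<le> Suc j" using card_image_le[OF F(1), of "\<lambda>\<psi>. \<psi> \<cdot> w"] F(2) by linarith
    finally show ?thesis using finite_subset[OF sub fin] by blast
  qed
qed

end

theorem theorem4p5:
  fixes K :: "('o, 'm) moncat" and A B :: "('o, 'm) ring_data"
  assumes "idempotent_complete_smc K"
    and "separable_ring K A"
    and "degree K A \<noteq> \<infinity>"
    and "separable_ring K B"
    and "indecomposable_ring K B"
  shows "finite {f. ring_morphism K A B f} \<and>
         enat (card {f. ring_morphism K A B f}) \<le> degree K A"
proof -
  interpret idempotent_complete_smc K by (rule assms)
  have B: "ring K B" "\<not> zero_object K (rob B)" "trivial_idempotents K B"
    using assms(5) unfolding indecomposable_ring_def trivial_idempotents_def by blast+
  have ex: "\<exists>d. has_degree K A d" using assms(3) by (auto simp: degree_def split: if_splits)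
  define d where "d = (LEAST d. has_degree K A d)"
  have d: "has_degree K A d" unfolding d_def by (rule LeastI_ex[OF ex])
  have deg: "degree K A = enat d" using ex by (simp add: degree_def d_def)
  from d obtain T s where tower: "splitting_tower K A T s" and zero: "zero_object K (rob (T (d + 1)))"
    unfolding has_degree_def by blast
  have T: "T 0 = unit_ring K" "T 1 = A" "s 0 = rone A"
    using tower unfolding splitting_tower_def by blast+
  have "ring_morphism K (T 0) B (rone B)"
    using B(1) mult_one(1)[OF B(1), of "rone B" "\<one>\<^bsub>K\<^esub>"]
    by (simp add: T unit_ring_def ring_morphism_def)
  from card_algebra_morphisms_le[OF tower zero B _ this, of d]
  have "finite {h. ring_morphism K A B h \<and> h \<cdot>\<^bsub>K\<^esub> rone A = rone B} \<and>
      card {h. ring_morphism K A B h \<and> h \<cdot>\<^bsub>K\<^esub> rone A = rone B} \<le> d"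
    using T by simp
  moreover have "{h. ring_morphism K A B h \<and> h \<cdot>\<^bsub>K\<^esub> rone A = rone B} = {h. ring_morphism K A B h}"
    using ring_morphism_laws(2) by blast
  ultimately show ?thesis by (simp add: deg)
qed

end
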